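(* Let $p\ge1$ and $N\ge1$ be integers and $k\in\{1,2,3,4,5\}$. Let $(\ell_1,\ell_2,\ell_3,\ell_4,\ell_5)=(1,p,2p-1,2p,3p-1)$. Then the following limit on the left exists (as $\tau=1/N+it$, $t\to0^+$) and $$\lim_{\tau\to1/N}\frac{q^{-\frac{e_k}{24(6p-1)}}}{2\eta(\tau)}\sum_{\varepsilon=(\varepsilon_1,\varepsilon_2)^T\in\{0,1\}^2}(-1)^{\varepsilon_1+\varepsilon_2}\,\widetilde{\theta}^{(2)}_{\mu_k+\varepsilon,c_1}(\tau)=-\frac12\lim_{\tau\to1/N}q^{-\frac{e_k}{24(6p-1)}}\,\widetilde{\Phi}^{(1,1,\ell_k)}_{(2,3,6p-1)}(\tau).$$
   Context: For $\tau\in\mathbb{H}$ put $q=e^{2\pi i\tau}$, $q^r=e^{2\pi ir\tau}$ for $r\in\mathbb{Q}$; $\eta(\tau)=q^{1/24}\prod_{n\ge1}(1-q^n)$. Limits $\tau\to1/N$ are vertical: $\tau=1/N+it$, $t\to0^+$. False theta functions: $A=\begin{pmatrix}2p+1&2\\2&3\end{pmatrix}$, $B(x,y)=x^TAy$, $Q(x)=\frac12B(x,x)$, $L=2\mathbb{Z}^2$, dual lattice $L^*=\frac12A^{-1}\mathbb{Z}^2$, $c_1=\frac{1}{\sqrt{3(6p-1)}}(3,-2)^T$. For $\mu\in L^*$, $\widetilde{\theta}^{(2)}_{\mu,c_1}(\tau)=\sum_{n\in L+\mu}\operatorname{sgn}(B(n,c_1))q^{Q(n)}$, with $\operatorname{sgn}(0)=0$.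 Data: $\mu_1=\frac12A^{-1}(2p+1,5)^T$, $\mu_2=\frac12A^{-1}(1,1)^T$, $\mu_3=\frac12A^{-1}(2p+3,3)^T$, $\mu_4=\frac12A^{-1}(2p+1,1)^T$, $\mu_5=\frac12A^{-1}(1,3)^T$; $e_1=(6p+5)^2$, $e_2=1$, $e_3=36p^2+84p+1$, $e_4=(6p+1)^2$, $e_5=48p+1$. The function $\widetilde\Phi$: for pairwise coprime positive integers $\mathbf p=(p_1,p_2,p_3)$, $P=p_1p_2p_3$, and an integer triple $\boldsymbol\ell=(l_1,l_2,l_3)$ with $0<l_j<p_j$, let $\chi_{\mathbf p}^{\boldsymbol\ell}:\mathbb{Z}/2P\mathbb{Z}\to\mathbb{Z}$ be given by $\chi_{\mathbf p}^{\boldsymbol\ell}(n)=-\epsilon_1\epsilon_2\epsilon_3$ if $n\equiv P\big(1+\sum_{j=1}^3\frac{\epsilon_jl_j}{p_j}\big)\pmod{2P}$ for some $(\epsilon_1,\epsilon_2,\epsilon_3)\in\{\pm1\}^3$, and $0$ otherwise; $\widetilde\Phi_{\mathbf p}^{\boldsymbol\ell}(\tau)=\sum_{n=0}^\infty\chi_{\mathbf p}^{\boldsymbol\ell}(n)q^{n^2/(4P)}$. *)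

theory Defs
  imports "HOL-Analysis.Analysis" "HOL-Number_Theory.Cong"
begin

definition qpow :: "complex \<Rightarrow> real \<Rightarrow> complex" where
  "qpow \<tau> r = exp (2 * of_real pi * \<i> * of_real r * \<tau>)"

definition dedekind_eta :: "complex \<Rightarrow> complex" where
  "dedekind_eta \<tau> = qpow \<tau> (1/24) * (\<Prod>n. 1 - qpow \<tau> (real (Suc n)))"

definition matA :: "int \<Rightarrow> real^2^2" where
  "matA p = vector [vector [2 * of_int p + 1, 2], vector [2, 3]]"

definition formB :: "int \<Rightarrow> real^2 \<Rightarrow> real^2 \<Rightarrow> real" where
  "formB p x y = x \<bullet> (matA p *v y)"

definition formQ :: "int \<Rightarrow> real^2 \<Rightarrow> real" where
  "formQ p x = 1/2 * formB p x x"

definition latticeL :: "(real^2) set" where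
  "latticeL = {x. \<forall>i. \<exists>m::int. x $ i = 2 * of_int m}"

definition c1 :: "int \<Rightarrow> real^2" where
  "c1 p = (1 / sqrt (3 * (6 * of_int p - 1))) *\<^sub>R vector [3, -2]"

(* The series runs over the coset L + \<mu>. It is defined here for every real vector \<mu>
   (only \<mu> in the dual lattice is of interest); since matA p is positive definite for
   p \<ge> 1, the sum converges absolutely for Im \<tau> > 0. *)
definition false_theta2 :: "int \<Rightarrow> real^2 \<Rightarrow> complex \<Rightarrow> complex" where
  "false_theta2 p \<mu> \<tau> =
     (\<Sum>\<^sub>\<infinity>n\<in>{l + \<mu> | l. l \<in> latticeL}.
        of_real (sgn (formB p n (c1 p))) * qpow \<tau> (formQ p n))"

definition mu_vec :: "int \<Rightarrow> nat \<Rightarrow> real^2" where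
  "mu_vec p k = (1/2) *\<^sub>R (matrix_inv (matA p) *v
     ([vector [2 * of_int p + 1, 5],
       vector [1, 1],
       vector [2 * of_int p + 3, 3],
       vector [2 * of_int p + 1, 1],
       vector [1, 3]] ! (k - 1)))"

definition e_num :: "int \<Rightarrow> nat \<Rightarrow> int" where
  "e_num p k = [(6*p + 5)^2, 1, 36*p^2 + 84*p + 1, (6*p + 1)^2, 48*p + 1] ! (k - 1)"

definition ell :: "int \<Rightarrow> nat \<Rightarrow> int" where
  "ell p k = [1, p, 2*p - 1, 2*p, 3*p - 1] ! (k - 1)"

(* A function on Z/2PZ is given as a 2P-periodic function of an integer.
   The residue P (1 + \<epsilon>1 l1/p1 + \<epsilon>2 l2/p2 + \<epsilon>3 l3/p3) is written without division.
   For pairwise coprime p_j and 0 < l_j < p_j the eight residues are distinct modulo 2P,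
   so at most one value v qualifies in the THE below. *)
definition chi :: "int \<times> int \<times> int \<Rightarrow> int \<times> int \<times> int \<Rightarrow> int \<Rightarrow> int" where
  "chi = (\<lambda>(p1, p2, p3) (l1, l2, l3) n.
     let P = p1 * p2 * p3;
         hit = (\<lambda>v. \<exists>\<epsilon>1\<in>{1, -1}. \<exists>\<epsilon>2\<in>{1, -1}. \<exists>\<epsilon>3\<in>{1, -1}.
           [n = P + \<epsilon>1 * l1 * p2 * p3 + \<epsilon>2 * l2 * p1 * p3 + \<epsilon>3 * l3 * p1 * p2] (mod (2 * P))
           \<and> v = - (\<epsilon>1 * \<epsilon>2 * \<epsilon>3))
     in if (\<exists>v. hit v) then (THE v. hit v) else 0)"

definition Phi_tilde :: "int \<times> int \<times> int \<Rightarrow> int \<times> int \<times> int \<Rightarrow> complex \<Rightarrow> complex" where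
  "Phi_tilde = (\<lambda>(p1, p2, p3) l \<tau>.
     \<Sum>n::nat. of_int (chi (p1, p2, p3) l (int n)) *
       qpow \<tau> (real (n^2) / (4 * of_int (p1 * p2 * p3))))"

end

theory Submission
  imports Defs "HOL-Library.Nat_Bijection" "HOL-Real_Asymp.Real_Asymp"
begin

text \<open>Put \<open>D = 6 p - 1\<close> and \<open>\<mu>\<^sub>k = A\<^sup>-\<^sup>1 (a, b) / 2\<close>. Since \<open>B(n, c\<^sub>1)\<close> is a positive multiple of the first
  coordinate of \<open>n\<close>, and at \<open>n = (m\<^sub>1, m\<^sub>2) + \<mu>\<^sub>k\<close>
  \<open>Q(n) = (6 m\<^sub>2 + b + 4 m\<^sub>1)\<^sup>2 / 24 + (2 D m\<^sub>1 + c)\<^sup>2 / (24 D)\<close> with \<open>c = 3 a - 2 b\<close>,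
  the alternating sum over \<open>m\<^sub>2\<close> is, by the pentagonal number theorem, \<open>\<eta>\<close> times the value at
  \<open>b + 4 m\<^sub>1\<close> of the even character modulo 12. What is left is a unary false theta series, and it equals
  the negative of \<open>\<Phi>\<close>: the two sides of the theorem agree for every \<open>\<tau>\<close>, not only in the
  limit. The limit exists because at \<open>\<tau> = 1/N + i t\<close> the series \<open>\<Phi>\<close> is a sum of
  \<open>exp (- s n\<^sup>2)\<close> against an odd periodic function of \<open>n\<close>, which has mean zero.\<close>

section \<open>Euler's pentagonal number theorem\<close>

text \<open>Each summand is the difference of two consecutive right-hand sides, so the sum
  telescopes. At \<open>m = n\<close> the product is empty and a pure power of \<open>q\<close> is
  left: one of the two new pentagonal terms in the induction step of
  \<open>shanks_identity\<close>.\<close>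

lemma shanks_telescope:
  fixes q :: "'a::comm_ring_1"
  assumes "m \<le> n"
  shows "(\<Sum>s\<le>m. (-1)^s * (\<Prod>i\<in>{s<..n}. 1 - q^i) *
            (q^(s * Suc n + triangle s) * (1 - q^Suc n) - q^(s * n + triangle s)))
       = (-1)^Suc m * (\<Prod>i\<in>{m<..n}. 1 - q^i) * q^(Suc m * Suc n + triangle m)"
  using assms
proof (induction m)
  case 0
  then show ?case by (simp add: algebra_simps)
next
  case (Suc m)
  define a where "a = (\<Prod>i\<in>{Suc m<..n}. 1 - q^i)"
  define X where "X = q^(Suc m * Suc n + triangle m)"
  have "{m<..n} = insert (Suc m) {Suc m<..n}" using Suc.prems by auto
  then have am: "(\<Prod>i\<in>{m<..n}. 1 - q^i) = (1 - q^Suc m) * a" by (simp add: a_def)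
  have X1: "q^(Suc m * n + triangle (Suc m)) = X"
    unfolding X_def by (rule arg_cong[where f="power q"]) (simp add: algebra_simps)
  have X2: "q^(Suc m * Suc n + triangle (Suc m)) = q^Suc m * X"
    unfolding X_def power_add[symmetric] by (rule arg_cong[where f="power q"]) (simp add: algebra_simps)
  have X3: "q^(Suc (Suc m) * Suc n + triangle (Suc m)) = q^Suc m * q^Suc n * X"
    unfolding X_def power_add[symmetric] by (rule arg_cong[where f="power q"]) (simp add: algebra_simps)
  have IH: "(\<Sum>s\<le>m. (-1)^s * (\<Prod>i\<in>{s<..n}. 1 - q^i) *
            (q^(s * Suc n + triangle s) * (1 - q^Suc n) - q^(s * n + triangle s)))
       = (-1)^Suc m * ((1 - q^Suc m) * a) * X"
    using Suc.IH Suc.prems by (simp only: am X_def)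
  show ?case
    unfolding sum.atMost_Suc IH X1 X2 X3 a_def[symmetric] by (simp add: algebra_simps)
qed

text \<open>Shanks' finite form of Euler's pentagonal number theorem.\<close>

lemma shanks_identity:
  fixes q :: "'a::comm_ring_1"
  shows "(\<Sum>s\<le>n. (-1)^s * (\<Prod>i\<in>{s<..n}. 1 - q^i) * q^(s * n + triangle s))
       = 1 + (\<Sum>k<n. (-1)^Suc k * (q^(Suc k * Suc k + triangle k) + q^(Suc k * Suc k + triangle (Suc k))))"
proof (induction n)
  case (Suc n)
  have prod_eq: "(\<Prod>i\<in>{s<..Suc n}. 1 - q^i) = (\<Prod>i\<in>{s<..n}. 1 - q^i) * (1 - q^Suc n)"
    if "s \<le> n" for s
  proof -
    have "{s<..Suc n} = insert (Suc n) {s<..n}" using that by auto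
    then show ?thesis by (simp add: mult.commute)
  qed
  have "(\<Sum>s\<le>Suc n. (-1)^s * (\<Prod>i\<in>{s<..Suc n}. 1 - q^i) * q^(s * Suc n + triangle s))
      = (\<Sum>s\<le>n. (-1)^s * (\<Prod>i\<in>{s<..n}. 1 - q^i) * (1 - q^Suc n) * q^(s * Suc n + triangle s))
        + (-1)^Suc n * q^(Suc n * Suc n + triangle (Suc n))"
    by (simp add: prod_eq mult.assoc)
  also have "(\<Sum>s\<le>n. (-1)^s * (\<Prod>i\<in>{s<..n}. 1 - q^i) * (1 - q^Suc n) * q^(s * Suc n + triangle s))
      = (\<Sum>s\<le>n. (-1)^s * (\<Prod>i\<in>{s<..n}. 1 - q^i) * q^(s * n + triangle s))
        + (\<Sum>s\<le>n. (-1)^s * (\<Prod>i\<in>{s<..n}. 1 - q^i) *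
            (q^(s * Suc n + triangle s) * (1 - q^Suc n) - q^(s * n + triangle s)))"
    unfolding sum.distrib[symmetric] by (rule sum.cong) (simp_all add: algebra_simps)
  \<comment> \<open>The telescoped sum gives the exponent \<open>Suc n * Suc n + triangle n\<close>,
    the split-off summand \<open>s = Suc n\<close> gives
    \<open>Suc n * Suc n + triangle (Suc n)\<close>.\<close>
  finally show ?case
    unfolding Suc.IH shanks_telescope[OF order_refl] sum.lessThan_Suc by (simp add: algebra_simps)
qed simp

lemma prod_one_minus_power_LIMSEQ:
  fixes q :: complex
  assumes "norm q < 1"
  shows "(\<lambda>n. \<Prod>i\<in>{0<..n}. 1 - q^i) \<longlonglongrightarrow> (\<Prod>n. 1 - q^Suc n)"
    and "(\<Prod>n. 1 - q^Suc n) \<noteq> 0"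
proof -
  have "summable (\<lambda>n. norm q ^ n)" using assms by (intro summable_geometric) simp
  then have "summable (\<lambda>n. norm q ^ Suc n)" by (subst summable_Suc_iff)
  then have "abs_convergent_prod (\<lambda>n. 1 - q^Suc n)"
    by (intro summable_imp_abs_convergent_prod) (simp add: norm_power norm_mult)
  then have cp: "convergent_prod (\<lambda>n. 1 - q^Suc n)" by (rule abs_convergent_prod_imp_convergent_prod)
  have "norm (q^Suc n) < 1" for n using assms power_less_one_iff[of "norm q" "Suc n"] by (simp only: norm_power) auto
  then have "1 - q^Suc n \<noteq> 0" for n
    by (metis eq_iff_diff_eq_0 less_irrefl norm_one)
  then show "(\<Prod>n. 1 - q^Suc n) \<noteq> 0" by (rule prodinf_nonzero[OF cp])
  have "(\<lambda>n. \<Prod>i\<le>n. 1 - q^Suc i) \<longlonglongrightarrow> (\<Prod>n. 1 - q^Suc n)"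
    by (rule convergent_prod_LIMSEQ[OF cp])
  moreover have "(\<Prod>i\<le>n. 1 - q^Suc i) = (\<Prod>i\<in>{0<..Suc n}. 1 - q^i)" for n
    by (rule prod.reindex_bij_witness[where i="\<lambda>i. i - 1" and j=Suc]) auto
  ultimately have "(\<lambda>n. \<Prod>i\<in>{0<..Suc n}. 1 - q^i) \<longlonglongrightarrow> (\<Prod>n. 1 - q^Suc n)" by simp
  then show "(\<lambda>n. \<Prod>i\<in>{0<..n}. 1 - q^i) \<longlonglongrightarrow> (\<Prod>n. 1 - q^Suc n)"
    by (rule filterlim_sequentially_Suc[THEN iffD1])
qed

text \<open>In Shanks' identity the summand \<open>s = 0\<close> is the partial product. For
  \<open>s \<ge> 1\<close> the exponent \<open>s * n + triangle s\<close> is at least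
  \<open>n\<close>, so these \<open>n\<close> summands total at most a constant times
  \<open>n * r^n\<close>, which tends to 0.\<close>

lemma pentagonal_LIMSEQ:
  fixes q :: complex
  assumes q: "norm q < 1"
  shows "(\<lambda>n. 1 + (\<Sum>k<n. (-1)^Suc k * (q^(Suc k * Suc k + triangle k) + q^(Suc k * Suc k + triangle (Suc k)))))
           \<longlonglongrightarrow> (\<Prod>n. 1 - q^Suc n)"
proof -
  define r where "r = norm q"
  have r: "0 \<le> r" "r < 1" using q by (auto simp: r_def)
  define B where "B = exp (1 / (1 - r))"
  \<comment> \<open>One constant bounds all finite products, whatever \<open>s\<close> and
    \<open>n\<close>, because \<open>1 + r^i \<le> exp (r^i)\<close> and the exponents sum to at
    most \<open>1 / (1 - r)\<close>.\<close>
  have bound: "norm (\<Prod>i\<in>I. 1 - q^i) \<le> B" if "finite I" for I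
  proof -
    have "norm (\<Prod>i\<in>I. 1 - q^i) \<le> (\<Prod>i\<in>I. 1 + r^i)"
      unfolding prod_norm[symmetric]
      by (intro prod_mono) (metis norm_ge_zero norm_one norm_power norm_triangle_ineq4 r_def)
    also have "\<dots> \<le> (\<Prod>i\<in>I. exp (r^i))" using r by (intro prod_mono) auto
    also have "\<dots> = exp (\<Sum>i\<in>I. r^i)" by (simp add: exp_sum that)
    also have "(\<Sum>i\<in>I. r^i) \<le> (\<Sum>i. r^i)"
      using r that by (intro sum_le_suminf summable_geometric) auto
    also have "\<dots> = 1 / (1 - r)" using r by (intro suminf_geometric) simp
    finally show ?thesis by (simp add: B_def)
  qed
  let ?t = "\<lambda>n s. (-1)^s * (\<Prod>i\<in>{s<..n}. 1 - q^i) * q^(s * n + triangle s)"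
  have "norm (\<Sum>s\<in>{0<..n}. ?t n s) \<le> B * (of_nat n * r^n)" for n
  proof -
    have "norm (?t n s) \<le> B * r^n" if "s \<in> {0<..n}" for s
    proof -
      have "n \<le> s * n + triangle s" using that by (cases s) auto
      then have "r^(s * n + triangle s) \<le> r^n" using r by (intro power_decreasing) auto
      moreover have "norm (\<Prod>i\<in>{s<..n}. 1 - q^i) \<le> B" by (rule bound) simp
      ultimately have "norm (\<Prod>i\<in>{s<..n}. 1 - q^i) * r^(s * n + triangle s) \<le> B * r^n"
        using r by (intro mult_mono) (auto simp: B_def)
      then show ?thesis by (simp add: norm_mult norm_power r_def)
    qed
    then have "norm (\<Sum>s\<in>{0<..n}. ?t n s) \<le> (\<Sum>s\<in>{0<..n}. B * r^n)"
      by (rule sum_norm_le)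
    then show ?thesis by (simp add: mult_ac)
  qed
  then have le: "\<forall>n. norm (\<Sum>s\<in>{0<..n}. ?t n s) \<le> B * (of_nat n * r^n)" by blast
  have lim: "(\<lambda>n. B * (of_nat n * r^n)) \<longlonglongrightarrow> B * 0"
    using r by (intro tendsto_mult tendsto_const powser_times_n_limit_0) auto
  have "(\<lambda>n. \<Sum>s\<in>{0<..n}. ?t n s) \<longlonglongrightarrow> 0"
    by (rule Lim_null_comparison[OF always_eventually[OF le]]) (use lim in simp)
  from tendsto_add[OF prod_one_minus_power_LIMSEQ(1)[OF q] this]
  have "(\<lambda>n. (\<Prod>i\<in>{0<..n}. 1 - q^i) + (\<Sum>s\<in>{0<..n}. ?t n s)) \<longlonglongrightarrow> (\<Prod>n. 1 - q^Suc n)" by simp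
  moreover have "(\<Prod>i\<in>{0<..n}. 1 - q^i) + (\<Sum>s\<in>{0<..n}. ?t n s) = (\<Sum>s\<le>n. ?t n s)" for n
  proof -
    have "{..n} = insert 0 {0<..n}" by auto
    then show ?thesis by simp
  qed
  ultimately show ?thesis by (simp only: shanks_identity)
qed

section \<open>Gaussian sums with periodic coefficients\<close>

text \<open>Partial sums of \<open>C\<close> are periodic because a full period sums to 0.
  Subtracting their mean \<open>a\<close> gives the antidifference mean zero again, so the
  construction can be iterated.\<close>

lemma periodic_antidifference:
  fixes C :: "nat \<Rightarrow> complex"
  assumes "M > 0" and per: "\<And>n. C (n + M) = C n" and zero: "(\<Sum>n<M. C n) = 0"
  obtains S where "\<And>n. S (n + M) = S n" "\<And>n. S (Suc n) - S n = C n" "(\<Sum>n<M. S n) = 0"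
proof -
  define a where "a = (\<Sum>n<M. \<Sum>j<n. C j) / of_nat M"
  define S where "S n = (\<Sum>j<n. C j) - a" for n
  have "S (n + M) = S n" for n
    by (induction n) (simp_all add: S_def zero per)
  moreover have "S (Suc n) - S n = C n" for n by (simp add: S_def)
  moreover have "(\<Sum>n<M. S n) = 0" using \<open>M > 0\<close> by (simp add: S_def a_def sum_subtractf)
  ultimately show ?thesis by (rule that)
qed

lemma periodic_nat_bounded:
  fixes S :: "nat \<Rightarrow> complex"
  assumes "M > 0" and per: "\<And>n. S (n + M) = S n"
  obtains B where "\<And>n. norm (S n) \<le> B"
proof -
  have add_mult: "S (r + k * M) = S r" for r k
    using per[of "r + _ * M"] by (induction k) (simp_all add: ac_simps)
  have "norm (S n) \<le> (\<Sum>j<M. norm (S j))" for n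
  proof -
    have "S n = S (n mod M)" using add_mult[of "n mod M" "n div M"] by simp
    also have "norm \<dots> \<le> (\<Sum>j<M. norm (S j))"
      using \<open>M > 0\<close> by (intro member_le_sum) auto
    finally show ?thesis .
  qed
  then show ?thesis by (rule that)
qed

lemma mult_exp_minus_le: "y * exp (- y) \<le> 1" for y :: real
proof -
  have "y \<le> exp y" using exp_ge_add_one_self[of y] by linarith
  then show ?thesis by (simp add: exp_minus field_simps)
qed

lemma square_mult_exp_minus_le: "y^2 * exp (- y) \<le> 4" if "y \<ge> 0" for y :: real
proof -
  have "(y/2 * exp (- (y/2)))^2 \<le> 1^2"
    using that by (intro power_mono mult_exp_minus_le) auto
  then show ?thesis by (simp add: power_mult_distrib exp_double[symmetric] power_divide)
qed

text \<open>The bound is uniform in \<open>s\<close>: it provides the majorant for Tannery's theorem.\<close>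

lemma gaussian_second_difference_bound:
  fixes s :: real
  assumes "s > 0"
  shows "\<bar>exp (- s * real n ^ 2) - 2 * exp (- s * real (n+1) ^ 2) + exp (- s * real (n+2) ^ 2)\<bar>
           \<le> 72 / real (n+1) ^ 2"
proof -
  define f where "f x = exp (- s * x ^ 2)" for x :: real
  define f' where "f' x = - 2 * s * x * f x" for x
  define f'' where "f'' x = (4 * s^2 * x^2 - 2 * s) * f x" for x
  have f: "(f has_real_derivative f' x) (at x)" for x
    unfolding f_def f'_def by (auto intro!: derivative_eq_intros simp: power2_eq_square)
  have f': "(f' has_real_derivative f'' x) (at x)" for x
    unfolding f'_def f''_def
    by (auto intro!: derivative_eq_intros f simp: f'_def power2_eq_square algebra_simps)
  have f_le: "0 < f x" "f x \<le> 1" for x using assms by (simp_all add: f_def)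
  show ?thesis
  proof (cases "n = 0")
    case True
    have "\<bar>f 0 - 2 * f 1 + f 2\<bar> \<le> 72" using f_le[of 0] f_le[of 1] f_le[of 2] by linarith
    then show ?thesis using True by (simp add: f_def)
  next
    case False
    \<comment> \<open>The mean value theorem is applied to
      \<open>x \<mapsto> f (x + 1) - f x\<close>, then to \<open>f'\<close>, which turns the second
      difference into a single value of \<open>f''\<close>.\<close>
    have "\<exists>z. real n < z \<and> z < real n + 1 \<and>
        (f (real n + 1 + 1) - f (real n + 1)) - (f (real n + 1) - f (real n))
          = (real n + 1 - real n) * (f' (z + 1) - f' z)"
      by (rule MVT2) (auto intro!: DERIV_diff f DERIV_shift[THEN iffD1])
    then obtain z where z: "real n < z" "z < real n + 1"
      "f (real n + 2) - 2 * f (real n + 1) + f (real n) = f' (z + 1) - f' z"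
      by (auto simp: algebra_simps)
    have "\<exists>w. z < w \<and> w < z + 1 \<and> f' (z + 1) - f' z = (z + 1 - z) * f'' w"
      by (rule MVT2) (auto intro!: f')
    then obtain w where w: "z < w" "f' (z + 1) - f' z = f'' w" by auto
    define y where "y = s * w^2"
    have wn: "real n < w" "0 < w" using z w by auto
    have "y \<ge> 0" using assms by (simp add: y_def)
    have "w^2 * f'' w = (4 * y^2 - 2 * y) * exp (- y)"
      by (simp add: f''_def f_def y_def algebra_simps power2_eq_square)
    moreover have "w^2 * \<bar>f'' w\<bar> = \<bar>w^2 * f'' w\<bar>" by (simp add: abs_mult)
    ultimately have "w^2 * \<bar>f'' w\<bar> = \<bar>4 * y^2 - 2 * y\<bar> * exp (- y)" by (simp add: abs_mult)
    also have "\<dots> \<le> (4 * y^2 + 2 * y) * exp (- y)"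
      using \<open>y \<ge> 0\<close> by (intro mult_right_mono) (auto simp: abs_le_iff)
    also have "\<dots> = 4 * (y^2 * exp (- y)) + 2 * (y * exp (- y))" by (simp add: algebra_simps)
    also have "\<dots> \<le> 18"
      using square_mult_exp_minus_le[OF \<open>y \<ge> 0\<close>] mult_exp_minus_le[of y] by linarith
    finally have "\<bar>f'' w\<bar> \<le> 18 / w^2" using wn by (simp add: field_simps)
    \<comment> \<open>For \<open>n \<ge> 1\<close> the point satisfies
      \<open>w > n \<ge> (n + 1) / 2\<close>. This fails for \<open>n = 0\<close>, hence the
      separate crude bound there.\<close>
    also have "\<dots> \<le> 18 / (real (n+1) / 2)^2"
      using False wn by (intro divide_left_mono power_mono) auto
    also have "\<dots> = 72 / real (n+1)^2" by (simp add: power_divide)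
    finally show ?thesis using z(3) w(2) by (simp add: f_def algebra_simps)
  qed
qed

lemma summable_gaussian_nat:
  fixes s :: real
  assumes "s > 0"
  shows "summable (\<lambda>n. exp (- s * real n ^ 2))"
proof (rule summable_comparison_test[OF exI, of 0])
  show "summable (\<lambda>n. exp (- s) ^ n)" using assms by (intro summable_geometric) simp
  show "\<forall>n\<ge>0. norm (exp (- s * real n ^ 2)) \<le> exp (- s) ^ n"
  proof safe
    fix n :: nat
    have "real n \<le> real n ^ 2" by (cases n) (auto simp: power2_eq_square)
    then show "norm (exp (- s * real n ^ 2)) \<le> exp (- s) ^ n"
      using assms by (simp add: exp_of_nat_mult[symmetric] mult.commute)
  qed
qed

text \<open>A periodic sequence of mean zero is the second difference of a periodic, hence bounded,
  sequence \<open>T\<close>. Summing by parts twice leaves boundary terms, which converge, and a series of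
  \<open>T\<close> against second differences of the Gaussian, which vanishes by Tannery's theorem.\<close>

lemma gaussian_sum_limit:
  fixes C :: "nat \<Rightarrow> complex"
  assumes "M > 0" and per: "\<And>n. C (n + M) = C n" and zero: "(\<Sum>n<M. C n) = 0"
  shows "\<exists>L. ((\<lambda>s. \<Sum>n. C n * of_real (exp (- s * real n ^ 2))) \<longlongrightarrow> L) (at_right 0)"
proof -
  obtain S where S: "\<And>n. S (n + M) = S n" "\<And>n. S (Suc n) - S n = C n" "(\<Sum>n<M. S n) = 0"
    by (rule periodic_antidifference[OF assms]) (rule that)
  obtain T where T: "\<And>n. T (n + M) = T n" "\<And>n. T (Suc n) - T n = S n"
    by (rule periodic_antidifference[OF \<open>M > 0\<close> S(1,3)]) (rule that)
  obtain B where B: "\<And>n. norm (T n) \<le> B"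
    by (rule periodic_nat_bounded[where S=T, OF \<open>M > 0\<close> T(1)]) (rule that)
  have "0 \<le> B" by (rule order_trans[OF norm_ge_zero B[of 0]])
  have C: "C n = T (n+2) - 2 * T (n+1) + T n" for n
    using T(2)[of n] T(2)[of "n+1"] S(2)[of n] by (simp add: algebra_simps)
  define f :: "real \<Rightarrow> nat \<Rightarrow> complex" where "f s n = of_real (exp (- s * real n ^ 2))" for s n
  define D where "D n s = T (n+2) * (f s n - 2 * f s (n+1) + f s (n+2))" for n s
  have "((\<lambda>s. \<Sum>n. D n s) \<longlongrightarrow> (\<Sum>n. 0)) (at_right 0)"
  proof (rule tannerys_theorem[THEN conjunct2, THEN conjunct2])
    show "((\<lambda>s. D n s) \<longlongrightarrow> 0) (at_right 0)" for n
    proof -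
      have "((\<lambda>s. D n s) \<longlongrightarrow> T (n+2) * (f 0 n - 2 * f 0 (n+1) + f 0 (n+2))) (at_right 0)"
        unfolding D_def f_def by (intro tendsto_intros)
      then show ?thesis by (simp add: f_def)
    qed
    have "norm (D n s) \<le> B * (72 / real (n+1)^2)" if "s > 0" for n s
    proof -
      have "f s n - 2 * f s (n+1) + f s (n+2) = of_real (exp (- s * real n ^ 2) - 2 * exp (- s * real (n+1) ^ 2) + exp (- s * real (n+2) ^ 2))"
        by (simp add: f_def)
      then have "norm (f s n - 2 * f s (n+1) + f s (n+2)) \<le> 72 / real (n+1)^2"
        using gaussian_second_difference_bound[OF that, of n] by (simp only: norm_of_real)
      then show ?thesis unfolding D_def norm_mult using B \<open>0 \<le> B\<close> by (intro mult_mono) auto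
    qed
    then show "\<forall>\<^sub>F (n, s) in at_top \<times>\<^sub>F at_right 0. norm (D n s) \<le> B * (72 / real (n+1)^2)"
      unfolding eventually_prod_filter case_prod_conv
      by (intro exI[of _ "\<lambda>_. True"] exI[of _ "\<lambda>s. s > 0"]) (simp add: eventually_at_right_less)
    have "summable (\<lambda>n. 1 / real n^2)"
      using inverse_power_summable[of 2, where 'a=real] by (simp add: inverse_eq_divide power_divide)
    then have "summable (\<lambda>n. 1 / real (Suc n)^2)" by (subst summable_Suc_iff)
    then have "summable (\<lambda>n. (B * 72) * (1 / real (Suc n)^2))" by (rule summable_mult)
    then show "summable (\<lambda>n. B * (72 / real (n+1)^2))" by simp
  qed simp
  moreover have "((\<lambda>s. T 0 * f s 0 + T 1 * f s 1 - 2 * T 1 * f s 0) \<longlongrightarrow> T 0 * f 0 0 + T 1 * f 0 1 - 2 * T 1 * f 0 0) (at_right 0)"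
    unfolding f_def by (intro tendsto_intros)
  ultimately have lim: "((\<lambda>s. (\<Sum>n. D n s) + (T 0 * f s 0 + T 1 * f s 1 - 2 * T 1 * f s 0))
      \<longlongrightarrow> (\<Sum>n. 0) + (T 0 * f 0 0 + T 1 * f 0 1 - 2 * T 1 * f 0 0)) (at_right 0)"
    by (rule tendsto_add)
  have eq: "(\<Sum>n. C n * f s n) = (\<Sum>n. D n s) + (T 0 * f s 0 + T 1 * f s 1 - 2 * T 1 * f s 0)"
    if "s > 0" for s
  proof -
    have sm: "summable (\<lambda>n. T (n+j) * f s (n+i))" for i j
    proof (rule summable_comparison_test[OF exI, of 0])
      show "summable (\<lambda>n. B * exp (- s * real (n+i) ^ 2))"
        using summable_gaussian_nat[OF that] by (intro summable_mult) (subst summable_iff_shift)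
      show "\<forall>n\<ge>0. norm (T (n+j) * f s (n+i)) \<le> B * exp (- s * real (n+i) ^ 2)"
        unfolding f_def norm_mult norm_of_real by (auto intro!: mult_right_mono B)
    qed
    have sm00: "summable (\<lambda>n. T n * f s n)" and sm10: "summable (\<lambda>n. T (n+1) * f s n)"
      and sm20: "summable (\<lambda>n. T (n+2) * f s n)" and sm21: "summable (\<lambda>n. T (n+2) * f s (n+1))"
      and sm22: "summable (\<lambda>n. T (n+2) * f s (n+2))"
      using sm[of 0 0] sm[of 1 0] sm[of 2 0] sm[of 2 1] sm[of 2 2] by simp_all
    \<comment> \<open>All three series are brought to the coefficient \<open>T (n+2)\<close>; the
      dropped initial terms are the boundary terms.\<close>
    have "(\<Sum>n. C n * f s n) = (\<Sum>n. T (n+2) * f s n - 2 * (T (n+1) * f s n) + T n * f s n)"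
      by (simp add: C algebra_simps)
    also have "\<dots> = (\<Sum>n. T (n+2) * f s n) - 2 * (\<Sum>n. T (n+1) * f s n) + (\<Sum>n. T n * f s n)"
      by (intro sums_unique[symmetric] sums_add sums_diff sums_mult summable_sums sm00 sm10 sm20)
    also have "(\<Sum>n. T n * f s n) = (\<Sum>n. T (n+2) * f s (n+2)) + (T 0 * f s 0 + T 1 * f s 1)"
      using suminf_split_initial_segment[OF sm00, of 2] by (simp add: numeral_2_eq_2)
    also have "(\<Sum>n. T (n+1) * f s n) = (\<Sum>n. T (n+2) * f s (n+1)) + T 1 * f s 0"
      using suminf_split_initial_segment[OF sm10, of 1] by (simp add: numeral_2_eq_2)
    finally have "(\<Sum>n. C n * f s n) = ((\<Sum>n. T (n+2) * f s n) - 2 * (\<Sum>n. T (n+2) * f s (n+1))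
        + (\<Sum>n. T (n+2) * f s (n+2))) + (T 0 * f s 0 + T 1 * f s 1 - 2 * T 1 * f s 0)"
      by (simp add: algebra_simps)
    also have "(\<Sum>n. T (n+2) * f s n) - 2 * (\<Sum>n. T (n+2) * f s (n+1)) + (\<Sum>n. T (n+2) * f s (n+2))
        = (\<Sum>n. T (n+2) * f s n - 2 * (T (n+2) * f s (n+1)) + T (n+2) * f s (n+2))"
      by (intro sums_unique sums_add sums_diff sums_mult summable_sums sm20 sm21 sm22)
    also have "\<dots> = (\<Sum>n. D n s)" by (simp add: D_def algebra_simps)
    finally show ?thesis .
  qed
  have "\<forall>\<^sub>F s in at_right 0. (\<Sum>n. D n s) + (T 0 * f s 0 + T 1 * f s 1 - 2 * T 1 * f s 0) = (\<Sum>n. C n * f s n)"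
    using eventually_at_right_less[of "0::real"] by eventually_elim (simp add: eq)
  from Lim_transform_eventually[OF lim this] show ?thesis unfolding f_def by blast
qed

section \<open>The coefficients of the unary false theta function\<close>

text \<open>The even primitive quadratic character modulo 12, the Kronecker symbol (12/w).\<close>

definition chi12 :: "int \<Rightarrow> int" where
  "chi12 w = (if w mod 12 = 1 \<or> w mod 12 = 11 then 1
              else if w mod 12 = 5 \<or> w mod 12 = 7 then - 1 else 0)"

lemma chi12_minus: "chi12 (- w) = chi12 w"
  by (auto simp: chi12_def zmod_zminus1_eq_if)

lemma chi12_diff_6: "chi12 (w - 6) = - chi12 w"
proof -
  define r where "r = w mod 12"
  have r: "0 \<le> r" "r < 12" by (simp_all add: r_def)
  have "(w - 6) mod 12 = (r - 6) mod 12" unfolding r_def by (simp add: mod_diff_left_eq)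
  also have "\<dots> = (if r < 6 then r + 6 else r - 6)"
    using r mod_add_self2[of "r - 6" 12] by auto
  finally show ?thesis unfolding chi12_def r_def[symmetric] using r by auto
qed

text \<open>The numbers \<open>6 + 3 * \<epsilon>1 + 2 * \<epsilon>2\<close> are 11, 7, 5, 1, the
  units modulo 12, and the product of the signs is the character value at each. The condition
  \<open>v \<noteq> 0\<close> excludes the non-units.\<close>

lemma chi12_eq:
  "v = chi12 w \<and> v \<noteq> 0 \<longleftrightarrow>
   (\<exists>\<epsilon>1\<in>{1,-1}. \<exists>\<epsilon>2\<in>{1,-1}. 12 dvd (w - 6 - 3 * \<epsilon>1 - 2 * \<epsilon>2) \<and> v = \<epsilon>1 * \<epsilon>2)"
proof -
  have "12 dvd (w - 6 - 3 - 2) \<longleftrightarrow> w mod 12 = 11" "12 dvd (w - 6 - 3 + 2) \<longleftrightarrow> w mod 12 = 7"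
    "12 dvd (w - 6 + 3 - 2) \<longleftrightarrow> w mod 12 = 5" "12 dvd (w - 6 + 3 + 2) \<longleftrightarrow> w mod 12 = 1"
    by presburger+
  then show ?thesis by (auto simp: chi12_def)
qed

context
  fixes D l :: int
  assumes D: "D > 0" "coprime D 12" and l: "\<not> D dvd l"
begin

lemma not_dvd_12_l: "\<not> D dvd 12 * l"
  using D l by (simp add: coprime_dvd_mult_right_iff)

text \<open>Spelled exactly like the predicate inside \<open>chi\<close>, factors 1 included, so
  that \<open>chi_conv_hit\<close> follows by unfolding alone.\<close>

definition hit :: "int \<Rightarrow> int \<Rightarrow> bool" where
  "hit n v \<longleftrightarrow> (\<exists>\<epsilon>1\<in>{1,-1}. \<exists>\<epsilon>2\<in>{1,-1}. \<exists>\<epsilon>3\<in>{1,-1}.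
     [n = 2 * 3 * D + \<epsilon>1 * 1 * 3 * D + \<epsilon>2 * 1 * 2 * D + \<epsilon>3 * l * 2 * 3] (mod (2 * (2 * 3 * D)))
     \<and> v = - (\<epsilon>1 * \<epsilon>2 * \<epsilon>3))"

lemma chi_conv_hit: "chi (2, 3, D) (1, 1, l) n = (if \<exists>v. hit n v then THE v. hit n v else 0)"
  by (simp only: chi_def hit_def Let_def prod.case)

lemma hit_conv_dvd:
  "hit n v \<longleftrightarrow> (\<exists>\<epsilon>1\<in>{1,-1}. \<exists>\<epsilon>2\<in>{1,-1}. \<exists>\<epsilon>3\<in>{1,-1}.
     12 * D dvd n - (6 * D + \<epsilon>1 * (3 * D) + \<epsilon>2 * (2 * D) + \<epsilon>3 * (6 * l)) \<and> v = - (\<epsilon>1 * \<epsilon>2 * \<epsilon>3))"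
proof -
  have "[n = 2 * 3 * D + \<epsilon>1 * 1 * 3 * D + \<epsilon>2 * 1 * 2 * D + \<epsilon>3 * l * 2 * 3] (mod (2 * (2 * 3 * D))) \<longleftrightarrow>
      12 * D dvd n - (6 * D + \<epsilon>1 * (3 * D) + \<epsilon>2 * (2 * D) + \<epsilon>3 * (6 * l))" for \<epsilon>1 \<epsilon>2 \<epsilon>3
    by (simp add: cong_iff_dvd_diff mult_ac)
  then show ?thesis by (simp only: hit_def)
qed

text \<open>Modulo \<open>D\<close> the congruence forces \<open>\<epsilon>3 = \<sigma>\<close>; dividing by \<open>D\<close> then leaves one modulo 12.\<close>

lemma hit_iff:
  assumes "\<sigma> \<in> {1, -1}" "n = D * w + \<sigma> * (6 * l)"
  shows "hit n v \<longleftrightarrow> v = - \<sigma> * chi12 w \<and> v \<noteq> 0"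
proof -
  have key: "12 * D dvd n - (6 * D + \<epsilon>1 * (3 * D) + \<epsilon>2 * (2 * D) + \<epsilon>3 * (6 * l)) \<longleftrightarrow>
        \<epsilon>3 = \<sigma> \<and> 12 dvd (w - 6 - 3 * \<epsilon>1 - 2 * \<epsilon>2)" if "\<epsilon>3 \<in> {1,-1}" for \<epsilon>1 \<epsilon>2 \<epsilon>3
  proof (cases "\<epsilon>3 = \<sigma>")
    case True
    have "n - (6 * D + \<epsilon>1 * (3 * D) + \<epsilon>2 * (2 * D) + \<epsilon>3 * (6 * l)) = (w - 6 - 3 * \<epsilon>1 - 2 * \<epsilon>2) * D"
      using True assms(2) by (simp add: algebra_simps)
    then show ?thesis using True D(1) by simp
  next
    case False
    then have s: "\<epsilon>3 = - \<sigma>" using that assms(1) by auto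
    have "\<not> D dvd n - (6 * D + \<epsilon>1 * (3 * D) + \<epsilon>2 * (2 * D) + \<epsilon>3 * (6 * l))"
    proof
      assume "D dvd n - (6 * D + \<epsilon>1 * (3 * D) + \<epsilon>2 * (2 * D) + \<epsilon>3 * (6 * l))"
      moreover have "n - (6 * D + \<epsilon>1 * (3 * D) + \<epsilon>2 * (2 * D) + \<epsilon>3 * (6 * l))
          = D * (w - 6 - 3 * \<epsilon>1 - 2 * \<epsilon>2) + \<sigma> * (12 * l)"
        using s assms(2) by (simp add: algebra_simps)
      ultimately have "D dvd \<sigma> * (12 * l)" by (simp add: dvd_add_right_iff)
      then show False using not_dvd_12_l assms(1) by auto
    qed
    then show ?thesis using False by (meson dvd_mult_right)
  qed
  have "hit n v \<longleftrightarrow> (\<exists>\<epsilon>1\<in>{1,-1}. \<exists>\<epsilon>2\<in>{1,-1}. 12 dvd (w - 6 - 3 * \<epsilon>1 - 2 * \<epsilon>2) \<and> v = - (\<epsilon>1 * \<epsilon>2 * \<sigma>))"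
    unfolding hit_conv_dvd using assms(1) by (simp only: key cong: bex_cong) blast
  also have "\<dots> \<longleftrightarrow> (\<exists>\<epsilon>1\<in>{1,-1}. \<exists>\<epsilon>2\<in>{1,-1}. 12 dvd (w - 6 - 3 * \<epsilon>1 - 2 * \<epsilon>2) \<and> - \<sigma> * v = \<epsilon>1 * \<epsilon>2)"
    using assms(1) by (intro bex_cong refl conj_cong) auto
  also have "\<dots> \<longleftrightarrow> v = - \<sigma> * chi12 w \<and> v \<noteq> 0"
    unfolding chi12_eq[symmetric] using assms(1) by auto
  finally show ?thesis .
qed

text \<open>By \<open>hit_iff\<close> at most one value qualifies, so \<open>THE\<close> is well
  defined; when \<open>chi12 w = 0\<close> none does, and the default 0 is the right value.\<close>

lemma chi_eq_chi12:
  assumes "\<sigma> \<in> {1, -1}"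
  shows "chi (2, 3, D) (1, 1, l) (D * w + \<sigma> * (6 * l)) = - \<sigma> * chi12 w"
  unfolding chi_conv_hit hit_iff[OF assms refl] by auto

text \<open>Complements \<open>chi_eq_chi12\<close>: the support lies in the two families where that
  lemma evaluates \<open>chi\<close>. Oddness of \<open>w\<close> later matches these points with
  the progression \<open>2 * D * m + c\<close>.\<close>

lemma chi_nonzeroE:
  assumes "chi (2, 3, D) (1, 1, l) n \<noteq> 0"
  obtains w \<sigma> where "odd w" "\<sigma> \<in> {1, -1}" "n = D * w + \<sigma> * (6 * l)"
proof -
  obtain \<epsilon>1 \<epsilon>2 \<epsilon>3 where e: "\<epsilon>1 \<in> {1,-1}" "\<epsilon>2 \<in> {1,-1}" "\<epsilon>3 \<in> {1,-1}"
    "12 * D dvd n - (6 * D + \<epsilon>1 * (3 * D) + \<epsilon>2 * (2 * D) + \<epsilon>3 * (6 * l))"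
    using assms unfolding chi_conv_hit by (auto simp only: hit_conv_dvd split: if_splits)
  then obtain j where "n - (6 * D + \<epsilon>1 * (3 * D) + \<epsilon>2 * (2 * D) + \<epsilon>3 * (6 * l)) = 12 * D * j" by (elim dvdE)
  then have "n = D * (12 * j + 6 + 3 * \<epsilon>1 + 2 * \<epsilon>2) + \<epsilon>3 * (6 * l)" by (simp add: algebra_simps)
  moreover have "odd (12 * j + 6 + 3 * \<epsilon>1 + 2 * \<epsilon>2)" using e by auto
  ultimately show ?thesis using that e(3) by blast
qed

text \<open>Negation sends \<open>(w, \<sigma>)\<close> to \<open>(- w, - \<sigma>)\<close>;
  \<open>chi12\<close> is even and the factor \<open>- \<sigma>\<close> changes sign.\<close>

lemma chi_minus: "chi (2, 3, D) (1, 1, l) (- n) = - chi (2, 3, D) (1, 1, l) n"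
proof -
  have *: "chi (2, 3, D) (1, 1, l) (- m) = - chi (2, 3, D) (1, 1, l) m"
    if nz: "chi (2, 3, D) (1, 1, l) m \<noteq> 0" for m
  proof -
    obtain w \<sigma> where w: "odd w" "\<sigma> \<in> {1, -1}" "m = D * w + \<sigma> * (6 * l)"
      by (rule chi_nonzeroE[OF nz])
    have m: "- m = D * (- w) + (- \<sigma>) * (6 * l)" by (simp add: w)
    have s: "- \<sigma> \<in> {1, -1}" using w by auto
    show ?thesis unfolding m chi_eq_chi12[OF s] unfolding w(3) chi_eq_chi12[OF w(2)] chi12_minus by simp
  qed
  \<comment> \<open>If \<open>chi\<close> vanishes at both \<open>n\<close> and \<open>- n\<close>
    the claim is trivial; otherwise \<open>*\<close> applies to one of them.\<close>
  show ?thesis using *[of n] *[of "-n"] by force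
qed

lemma chi_periodic: "chi (2, 3, D) (1, 1, l) (n + 12 * D * j) = chi (2, 3, D) (1, 1, l) n"
proof -
  have "12 * D dvd (n + 12 * D * j) - x \<longleftrightarrow> 12 * D dvd n - x" for x
  proof -
    have "(n + 12 * D * j) - x = (n - x) + 12 * D * j" by simp
    then show ?thesis by (simp only: dvd_add_left_iff[OF dvd_triv_left])
  qed
  then have "hit (n + 12 * D * j) = hit n" unfolding hit_conv_dvd fun_eq_iff by simp
  then show ?thesis by (simp add: chi_conv_hit)
qed

end

section \<open>Theta series\<close>

lemma qpow_add: "qpow \<tau> (r + s) = qpow \<tau> r * qpow \<tau> s"
  by (simp add: qpow_def exp_add[symmetric] algebra_simps)

lemma norm_qpow: "norm (qpow \<tau> r) = exp (- (2 * pi * Im \<tau>) * r)"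
  by (simp add: qpow_def norm_exp_eq_Re)

lemma qpow_of_nat: "qpow \<tau> (real n) = qpow \<tau> 1 ^ n"
  by (simp add: qpow_def exp_of_nat_mult[symmetric] algebra_simps)

lemma norm_qpow_1_less:
  assumes "Im \<tau> > 0"
  shows "norm (qpow \<tau> 1) < 1"
  using assms by (simp add: norm_qpow)

lemma dedekind_eta_altdef:
  "dedekind_eta \<tau> = qpow \<tau> (1/24) * (\<Prod>n. 1 - qpow \<tau> 1 ^ Suc n)"
  by (simp only: dedekind_eta_def qpow_of_nat)

lemma dedekind_eta_nonzero:
  assumes "Im \<tau> > 0"
  shows "dedekind_eta \<tau> \<noteq> 0"
  using prod_one_minus_power_LIMSEQ(2)[OF norm_qpow_1_less[OF assms]]
  unfolding dedekind_eta_altdef by (simp add: qpow_def)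

lemma summable_gaussian_int:
  fixes s :: real
  assumes "s > 0"
  shows "(\<lambda>m. exp (- s * real_of_int m ^ 2)) summable_on UNIV"
proof -
  let ?f = "\<lambda>m. exp (- s * real_of_int m ^ 2)"
  have nat: "(\<lambda>n. exp (- s * real n ^ 2)) summable_on A" for A
  proof (rule summable_on_subset_banach[of _ UNIV])
    show "(\<lambda>n. exp (- s * real n ^ 2)) summable_on UNIV"
      using summable_gaussian_nat[OF assms] by (intro norm_summable_imp_summable_on) simp
  qed simp
  have 1: "?f summable_on range int"
    by (subst summable_on_reindex) (use nat[of UNIV] in \<open>auto simp: o_def\<close>)
  have 2: "?f summable_on (\<lambda>n. - int n) ` {0<..}"
    by (subst summable_on_reindex) (use nat[of "{0<..}"] in \<open>auto simp: o_def inj_on_def\<close>)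
  have disj: "range int \<inter> (\<lambda>n. - int n) ` {0<..} = {}" by auto
  have un: "range int \<union> (\<lambda>n. - int n) ` {0<..} = UNIV"
  proof -
    have "m \<in> range int \<union> (\<lambda>n. - int n) ` {0<..}" for m
    proof (cases "m \<ge> 0")
      case True
      then have "m = int (nat m)" by simp
      then show ?thesis by blast
    next
      case False
      then have "m = - int (nat (- m))" "nat (- m) \<in> {0<..}" by auto
      then show ?thesis by blast
    qed
    then show ?thesis by blast
  qed
  show ?thesis using summable_on_Un_disjoint[OF 1 2 disj] by (simp only: un)
qed

lemma summable_gaussian_int2:
  fixes s t :: real
  assumes "s > 0" "t > 0"
  shows "(\<lambda>(x, y). exp (- s * real_of_int x ^ 2) * exp (- t * real_of_int y ^ 2)) summable_on UNIV"
proof -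
  have "(\<lambda>(x, y). exp (- s * real_of_int x ^ 2) * exp (- t * real_of_int y ^ 2)) summable_on UNIV \<times> UNIV"
    by (rule summable_on_SigmaI[where g="\<lambda>x. exp (- s * real_of_int x ^ 2) * (\<Sum>\<^sub>\<infinity>y. exp (- t * real_of_int y ^ 2))"])
      (use summable_gaussian_int[OF assms(1)] summable_gaussian_int[OF assms(2)] in
        \<open>auto intro!: has_sum_cmult_right has_sum_infsum summable_on_cmult_left\<close>)
  then show ?thesis by simp
qed

lemma summable_qpow_int:
  assumes "Im \<tau> > 0" "d > 0" and inj: "inj h" and c: "\<And>m. norm (c m) \<le> 1"
  shows "(\<lambda>m::int. c m * qpow \<tau> (of_int (h m) ^ 2 / d)) summable_on UNIV"
proof -
  define s where "s = 2 * pi * Im \<tau> / d"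
  have "s > 0" using assms by (simp add: s_def)
  have "(\<lambda>m. exp (- s * real_of_int m ^ 2)) summable_on range h"
    by (rule summable_on_subset_banach[OF summable_gaussian_int[OF \<open>s > 0\<close>]]) simp
  then have "(\<lambda>m. exp (- s * real_of_int (h m) ^ 2)) summable_on UNIV"
    by (subst (asm) summable_on_reindex[OF inj]) (simp add: o_def)
  then have "(\<lambda>m. norm (c m * qpow \<tau> (of_int (h m) ^ 2 / d))) summable_on UNIV"
  proof (rule Infinite_Sum.abs_summable_on_comparison_test')
    show "norm (c m * qpow \<tau> (of_int (h m) ^ 2 / d)) \<le> exp (- s * real_of_int (h m) ^ 2)" for m
      using c[of m] unfolding norm_mult norm_qpow s_def by (simp add: mult_left_le_one_le)
  qed
  then show ?thesis by (rule abs_summable_summable)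
qed

section \<open>Alternating theta series as multiples of eta\<close>

definition alt_sign :: "int \<Rightarrow> complex" where
  "alt_sign m = (if even m then 1 else - 1)"

lemma alt_sign_add: "alt_sign (m + n) = alt_sign m * alt_sign n"
  by (auto simp: alt_sign_def)

lemma alt_sign_minus: "alt_sign (- m) = alt_sign m"
  by (auto simp: alt_sign_def)

lemma norm_alt_sign: "norm (alt_sign m) = 1"
  by (auto simp: alt_sign_def)

lemma alt_sign_of_nat: "alt_sign (int n) = (- 1) ^ n"
  by (simp add: alt_sign_def)

lemma summable_theta:
  assumes "Im \<tau> > 0"
  shows "(\<lambda>m. alt_sign m * qpow \<tau> (of_int (6 * m + r) ^ 2 / 24)) summable_on UNIV"
  by (rule summable_qpow_int[OF assms]) (auto simp: norm_alt_sign inj_def)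

lemma real_triangle: "real (triangle n) = real n * (real n + 1) / 2"
  by (induction n) (auto simp: field_simps)

text \<open>Since \<open>(6 * m + 1)^2 / 24 = 1/24 + m * (3 * m + 1) / 2\<close>, this is the
  pentagonal number theorem: the indices \<open>k + 1\<close> and \<open>- (k + 1)\<close> give the
  two exponents in Shanks' sum.\<close>

lemma dedekind_eta_has_sum:
  assumes "Im \<tau> > 0"
  shows "((\<lambda>m. alt_sign m * qpow \<tau> (of_int (6 * m + 1) ^ 2 / 24)) has_sum dedekind_eta \<tau>) UNIV"
proof -
  define f where "f m = alt_sign m * qpow \<tau> (of_int (6 * m + 1) ^ 2 / 24)" for m
  define q where "q = qpow \<tau> 1"
  have f_pos: "f (int n) = qpow \<tau> (1/24) * ((- 1) ^ n * q ^ (n * n + triangle n))" for n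
  proof -
    have "of_int (6 * int n + 1) ^ 2 / 24 = 1/24 + real (n * n + triangle n)"
      by (simp add: real_triangle power2_eq_square field_simps)
    then show ?thesis unfolding f_def alt_sign_of_nat q_def
      by (simp only: qpow_add qpow_of_nat mult_ac)
  qed
  have f_neg: "f (- int (Suc n)) = qpow \<tau> (1/24) * ((- 1) ^ Suc n * q ^ (Suc n * Suc n + triangle n))" for n
  proof -
    have "of_int (6 * (- int (Suc n)) + 1) ^ 2 / 24 = 1/24 + real (Suc n * Suc n + triangle n)"
      by (simp add: real_triangle power2_eq_square field_simps)
    then show ?thesis unfolding f_def alt_sign_minus alt_sign_of_nat q_def
      by (simp only: qpow_add qpow_of_nat mult_ac)
  qed
  have part: "(\<Sum>m\<in>{- int n..int n}. f m) = qpow \<tau> (1/24) *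
      (1 + (\<Sum>k<n. (-1)^Suc k * (q^(Suc k * Suc k + triangle k) + q^(Suc k * Suc k + triangle (Suc k)))))" for n
  proof (induction n)
    case 0
    then show ?case using f_pos[of 0] by simp
  next
    case (Suc n)
    have "{- int (Suc n)..int (Suc n)} = insert (int (Suc n)) (insert (- int (Suc n)) {- int n..int n})"
      by auto
    moreover have "int (Suc n) \<notin> insert (- int (Suc n)) {- int n..int n}" "- int (Suc n) \<notin> {- int n..int n}"
      by auto
    ultimately have "(\<Sum>m\<in>{- int (Suc n)..int (Suc n)}. f m) = f (int (Suc n)) + (f (- int (Suc n)) + (\<Sum>m\<in>{- int n..int n}. f m))"
      by (simp only: sum.insert finite_insert finite_atLeastAtMost_int simp_thms)
    then show ?case
      unfolding Suc.IH f_pos f_neg sum.lessThan_Suc by (simp only: algebra_simps)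
  qed
  have lim1: "(\<lambda>n. \<Sum>m\<in>{- int n..int n}. f m) \<longlonglongrightarrow> dedekind_eta \<tau>"
    unfolding part dedekind_eta_altdef q_def
    by (intro tendsto_mult tendsto_const pentagonal_LIMSEQ norm_qpow_1_less assms)
  have "f summable_on UNIV" unfolding f_def by (rule summable_theta[OF assms])
  then obtain S where S: "(f has_sum S) UNIV" unfolding summable_on_def by blast
  \<comment> \<open>Symmetric intervals eventually contain every finite set, so the unordered sum is
    the limit of the symmetric partial sums.\<close>
  have "filterlim (\<lambda>n. {- int n..int n}) (finite_subsets_at_top UNIV) sequentially"
    unfolding filterlim_finite_subsets_at_top
  proof safe
    fix X :: "int set" assume "finite X"
    then obtain N where N: "\<forall>x\<in>X. \<bar>x\<bar> \<le> int N"
      by (metis abs_of_nonneg bdd_above_def bdd_above_finite finite_imageI imageI nat_le_iff of_nat_0_le_iff order_refl)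
    have "X \<subseteq> {- int n..int n}" if "n \<ge> N" for n using N that by force
    then show "\<forall>\<^sub>F n in sequentially. finite {- int n..int n} \<and> X \<subseteq> {- int n..int n} \<and> {- int n..int n} \<subseteq> UNIV"
      unfolding eventually_sequentially by (intro exI[of _ N]) simp
  qed
  from filterlim_compose[OF S[unfolded has_sum_def] this]
  have "(\<lambda>n. \<Sum>m\<in>{- int n..int n}. f m) \<longlonglongrightarrow> S" .
  with lim1 have "S = dedekind_eta \<tau>" by (metis LIMSEQ_unique)
  with S show ?thesis unfolding f_def by simp
qed

text \<open>Shifting \<open>m\<close> by \<open>j\<close> replaces \<open>r\<close> by
  \<open>r + 6 * j\<close> at the cost of the sign \<open>alt_sign j\<close>. This reduces odd
  \<open>r\<close> to 1, 3 and -1; the case -1 is the reflection of the case 1.\<close>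

lemma theta_has_sum:
  assumes \<tau>: "Im \<tau> > 0" and "odd r"
  shows "((\<lambda>m. alt_sign m * qpow \<tau> (of_int (6 * m + r) ^ 2 / 24)) has_sum
           of_int (chi12 r) * dedekind_eta \<tau>) UNIV"
proof -
  define g where "g r m = alt_sign m * qpow \<tau> (of_int (6 * m + r) ^ 2 / 24)" for r m
  have shift: "(g (6 * j + r) has_sum alt_sign j * x) UNIV" if "(g r has_sum x) UNIV" for j r x
  proof -
    have "((\<lambda>m. g r (m + j)) has_sum x) UNIV"
      using that by (subst has_sum_reindex_bij_betw[where B=UNIV])
        (auto intro!: bij_betwI[where g="\<lambda>m. m - j"])
    then have "((\<lambda>m. alt_sign j * g r (m + j)) has_sum alt_sign j * x) UNIV"
      by (rule has_sum_cmult_right)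
    moreover have "alt_sign j * g r (m + j) = g (6 * j + r) m" for m
      by (auto simp: g_def alt_sign_def algebra_simps)
    ultimately show ?thesis by simp
  qed
  have base1: "(g 1 has_sum dedekind_eta \<tau>) UNIV"
    using dedekind_eta_has_sum[OF \<tau>] by (simp add: g_def[abs_def])
  have "((\<lambda>m. g 1 (- m)) has_sum dedekind_eta \<tau>) UNIV"
    using base1 by (subst has_sum_reindex_bij_betw[where B=UNIV]) (auto intro!: bij_betwI[where g=uminus])
  moreover have "g 1 (- m) = g (- 1) m" for m
    unfolding g_def alt_sign_minus by (simp add: power2_eq_square algebra_simps)
  ultimately have base5: "(g (- 1) has_sum dedekind_eta \<tau>) UNIV" by simp
  have base3: "(g 3 has_sum 0) UNIV"
  proof -
    obtain x where x: "(g 3 has_sum x) UNIV"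
      using summable_theta[OF \<tau>, of 3] unfolding g_def[abs_def] summable_on_def by blast
    \<comment> \<open>The reflection \<open>m \<mapsto> - 1 - m\<close> negates
      \<open>6 * m + 3\<close> and flips the alternating sign, so the sum equals its own
      negative.\<close>
    have "((\<lambda>m. g 3 (- 1 - m)) has_sum x) UNIV"
      using x by (subst has_sum_reindex_bij_betw[where B=UNIV]) (auto intro!: bij_betwI[where g="\<lambda>m. - 1 - m"])
    moreover have "g 3 (- 1 - m) = - g 3 m" for m
      by (auto simp: g_def alt_sign_def power2_eq_square algebra_simps)
    ultimately have "((\<lambda>m. - g 3 m) has_sum x) UNIV" by simp
    with x have "x = - x" using has_sum_uminus has_sum_unique by blast
    then have "x = 0" by simp
    with x show ?thesis by simp
  qed
  consider j where "r = 6 * j + 1" | j where "r = 6 * j + 3" | j where "r = 6 * j + - 1"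
  proof -
    have "(\<exists>j. r = 6 * j + 1) \<or> (\<exists>j. r = 6 * j + 3) \<or> (\<exists>j. r = 6 * j + - 1)"
      using \<open>odd r\<close> by presburger
    then show ?thesis using that by blast
  qed
  then have "(g r has_sum of_int (chi12 r) * dedekind_eta \<tau>) UNIV"
  proof cases
    case 1
    have "(6 * j + 1) mod 12 = (if even j then 1 else 7)" by presburger
    then have "of_int (chi12 r) = alt_sign j" by (simp add: 1 chi12_def alt_sign_def)
    then show ?thesis using shift[OF base1, of j] 1 by simp
  next
    case 2
    have "(6 * j + 3) mod 12 = (if even j then 3 else 9)" by presburger
    then have "chi12 r = 0" by (simp add: 2 chi12_def)
    then show ?thesis using shift[OF base3, of j] 2 by simp
  next
    case 3
    have "(6 * j + - 1) mod 12 = (if even j then 11 else 5)" by presburger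
    then have "of_int (chi12 r) = alt_sign j" by (simp add: 3 chi12_def alt_sign_def)
    then show ?thesis using shift[OF base5, of j] 3 by simp
  qed
  then show ?thesis by (simp only: g_def[abs_def])
qed

section \<open>The unary false theta series and \<open>Phi_tilde\<close>\<close>

text \<open>The argument \<open>2 * D * m + c\<close> is
  \<open>D * (2 * m + u) + \<sigma> * (6 * l)\<close>, where \<open>chi\<close> is known. As
  \<open>chi\<close> is odd, passing to the absolute value \<open>h m\<close> absorbs the factor
  \<open>sgn\<close>, and \<open>h\<close> maps the integers injectively onto a set containing the
  support of \<open>chi\<close> in the naturals.\<close>

lemma infsum_unary_eq_Phi_tilde:
  assumes D: "D > 0" "coprime D 12" and l: "\<not> D dvd l"
    and \<sigma>: "\<sigma> \<in> {1, -1}" and u: "odd u" and c: "c = \<sigma> * (6 * l) + u * D" and \<tau>: "Im \<tau> > 0"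
  shows "(\<Sum>\<^sub>\<infinity>m. of_int (\<sigma> * chi12 (2 * m + u) * sgn (2 * D * m + c)) *
            qpow \<tau> (of_int (2 * D * m + c) ^ 2 / (24 * of_int D)))
       = - Phi_tilde (2, 3, D) (1, 1, l) \<tau>"
proof -
  define g where "g n = of_int (chi (2, 3, D) (1, 1, l) (int n)) * qpow \<tau> (real n ^ 2 / (24 * of_int D))" for n
  define h where "h m = nat \<bar>2 * D * m + c\<bar>" for m
  \<comment> \<open>The case \<open>j = 1\<close> shows that \<open>2 * D * m + c\<close> is never
    0; \<open>j = 2\<close> shows that no two of its values are opposite, which makes
    \<open>h\<close> injective.\<close>
  have not_dvd: "\<not> D dvd j * c" if "j \<in> {1, 2}" for j
  proof
    assume "D dvd j * c"
    then have "D dvd (2 * \<sigma>) * (j * c)" by (rule dvd_mult)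
    moreover have "(2 * \<sigma>) * (j * c) = j * (12 * l) + D * (2 * \<sigma> * j * u)"
      using \<sigma> by (auto simp: c algebra_simps)
    ultimately have "D dvd j * (12 * l)" by (simp add: dvd_add_left_iff)
    moreover have "coprime D j" using that D(2) coprime_divisors[of D D 2 12] by auto
    ultimately show False using not_dvd_12_l[OF D l] by (simp add: coprime_dvd_mult_right_iff)
  qed
  have nz: "2 * D * m + c \<noteq> 0" for m
  proof
    assume "2 * D * m + c = 0"
    then have "1 * c = D * (- 2 * m)" by (simp add: algebra_simps)
    then show False using not_dvd[of 1] by (simp only: dvd_triv_left) simp
  qed
  have inj: "inj h"
  proof (rule injI)
    fix m m' assume "h m = h m'"
    then have "\<bar>2 * D * m + c\<bar> = \<bar>2 * D * m' + c\<bar>" by (simp add: h_def eq_nat_nat_iff)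
    then consider "2 * D * m + c = 2 * D * m' + c" | "2 * D * m + c = - (2 * D * m' + c)"
      by (auto simp: abs_eq_iff)
    then show "m = m'"
    proof cases
      case 1
      then show ?thesis using D(1) by simp
    next
      case 2
      then have "2 * c = D * (- 2 * m - 2 * m')" by (simp add: algebra_simps)
      then show ?thesis using not_dvd[of 2] by (simp only: dvd_triv_left) simp
    qed
  qed
  have term_eq: "of_int (\<sigma> * chi12 (2 * m + u) * sgn (2 * D * m + c)) *
      qpow \<tau> (of_int (2 * D * m + c) ^ 2 / (24 * of_int D)) = - g (h m)" for m
  proof -
    have x: "2 * D * m + c = D * (2 * m + u) + \<sigma> * (6 * l)" by (simp add: c algebra_simps)
    have chi: "chi (2, 3, D) (1, 1, l) (2 * D * m + c) = - \<sigma> * chi12 (2 * m + u)"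
      unfolding x by (rule chi_eq_chi12[OF D l \<sigma>])
    have sq: "real (h m) ^ 2 = of_int (2 * D * m + c) ^ 2" by (simp add: h_def)
    have h: "int (h m) = \<bar>2 * D * m + c\<bar>" by (simp add: h_def)
    show ?thesis
    proof (cases "2 * D * m + c > 0")
      case True
      then have "\<bar>2 * D * m + c\<bar> = 2 * D * m + c" "sgn (2 * D * m + c) = 1" by auto
      then show ?thesis unfolding g_def sq h by (simp only: chi) simp
    next
      case False
      then have "\<bar>2 * D * m + c\<bar> = - (2 * D * m + c)" "sgn (2 * D * m + c) = - 1" using nz[of m] by auto
      then show ?thesis unfolding g_def sq h by (simp only: chi chi_minus[OF D l]) simp
    qed
  qed
  \<comment> \<open>A support point of sign \<open>\<sigma>\<close> lies in the progression
    \<open>2 * D * m + c\<close>; for the other sign its negative does. Both \<open>w\<close> and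
    \<open>u\<close> being odd makes the difference even.\<close>
  have outside: "g n = 0" if "n \<notin> range h" for n
  proof (rule ccontr)
    assume "g n \<noteq> 0"
    then have "chi (2, 3, D) (1, 1, l) (int n) \<noteq> 0" by (auto simp: g_def)
    then obtain w \<sigma>' where w: "odd w" "\<sigma>' \<in> {1, -1}" "int n = D * w + \<sigma>' * (6 * l)"
      by (rule chi_nonzeroE[OF D l])
    show False
    proof (cases "\<sigma>' = \<sigma>")
      case True
      have "int n = D * (w - u) + c" using w True by (simp add: c algebra_simps)
      moreover have "even (w - u)" using w(1) u by simp
      then obtain j where "w - u = 2 * j" by (rule evenE)
      ultimately have "int n = 2 * D * j + c" by (simp add: algebra_simps)
      then have "n = h j" by (simp add: h_def)
      then show False using that by blast
    next
      case False
      then have "\<sigma>' = - \<sigma>" using \<sigma> w by auto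
      then have "- int n = D * (- w - u) + c" using w by (simp add: c algebra_simps)
      moreover have "even (- w - u)" using w(1) u by simp
      then obtain j where "- w - u = 2 * j" by (rule evenE)
      ultimately have "- int n = 2 * D * j + c" by (simp add: algebra_simps)
      then have "n = h j" unfolding h_def by linarith
      then show False using that by blast
    qed
  qed
  have "summable (\<lambda>n. norm (g n))"
  proof (rule summable_comparison_test[OF exI, of 0])
    define s where "s = 2 * pi * Im \<tau> / (24 * of_int D)"
    show "summable (\<lambda>n. exp (- s * real n ^ 2))"
      using D \<tau> by (intro summable_gaussian_nat) (simp add: s_def)
    have le: "norm (of_int (chi (2, 3, D) (1, 1, l) n) :: complex) \<le> 1" for n
    proof (cases "chi (2, 3, D) (1, 1, l) n = 0")
      case False
      then obtain w \<sigma>' where w: "odd w" "\<sigma>' \<in> {1, -1}" "n = D * w + \<sigma>' * (6 * l)"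
        by (rule chi_nonzeroE[OF D l])
      show ?thesis unfolding w(3) chi_eq_chi12[OF D l w(2)] using w(2) by (auto simp: chi12_def)
    qed simp
    have "norm (g n) \<le> exp (- s * real n ^ 2)" for n
    proof -
      have "norm (qpow \<tau> (real n ^ 2 / (24 * of_int D))) = exp (- s * real n ^ 2)"
        unfolding norm_qpow s_def by (rule arg_cong[where f=exp]) simp
      then show ?thesis
        unfolding g_def norm_mult by (simp only:) (intro mult_left_le_one_le le norm_ge_zero exp_ge_zero)
    qed
    then show "\<forall>n\<ge>0. norm (norm (g n)) \<le> exp (- s * real n ^ 2)" by simp
  qed
  then have "(g has_sum suminf g) UNIV"
    by (intro norm_summable_imp_has_sum summable_sums) (auto intro: summable_norm_cancel)
  then have "infsum g UNIV = suminf g" by (rule infsumI)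
  also have "suminf g = Phi_tilde (2, 3, D) (1, 1, l) \<tau>"
    by (simp add: Phi_tilde_def g_def[abs_def])
  finally have "Phi_tilde (2, 3, D) (1, 1, l) \<tau> = infsum g UNIV" by simp
  also have "\<dots> = infsum g (range h)" using outside by (intro infsum_cong_neutral) auto
  also have "\<dots> = (\<Sum>\<^sub>\<infinity>m. g (h m))" by (simp add: infsum_reindex[OF inj] o_def)
  finally show ?thesis by (simp only: term_eq infsum_uminus)
qed

section \<open>Reduction of the double series to a unary one\<close>

text \<open>The linear substitution \<open>h\<close> is injective, so a product of two Gaussians
  over all integer pairs is a majorant.\<close>

lemma summable_double_theta:
  fixes b c D :: int
  assumes "Im \<tau> > 0" "D > 0"
  shows "(\<lambda>(m1, m2). alt_sign (m1 + m2) * of_int (sgn (2 * D * m1 + c)) *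
            qpow \<tau> (of_int (6 * m2 + b + 4 * m1) ^ 2 / 24 + of_int (2 * D * m1 + c) ^ 2 / (24 * of_int D)))
         summable_on UNIV"
proof -
  define s where "s = 2 * pi * Im \<tau> / (24 * of_int D)"
  define t where "t = 2 * pi * Im \<tau> / 24"
  define G where "G = (\<lambda>(x, y). exp (- s * real_of_int x ^ 2) * exp (- t * real_of_int y ^ 2))"
  define h where "h = (\<lambda>(m1, m2). (2 * D * m1 + c, 6 * m2 + b + 4 * m1))"
  have "s > 0" "t > 0" using assms by (simp_all add: s_def t_def)
  then have "G summable_on UNIV" unfolding G_def by (rule summable_gaussian_int2)
  then have "G summable_on range h" by (rule summable_on_subset_banach) simp
  moreover have "inj h" using assms(2) by (auto simp: h_def inj_def)
  ultimately have "(G \<circ> h) summable_on UNIV" by (simp add: summable_on_reindex)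
  then have "(\<lambda>z. norm ((\<lambda>(m1, m2). alt_sign (m1 + m2) * of_int (sgn (2 * D * m1 + c)) *
            qpow \<tau> (of_int (6 * m2 + b + 4 * m1) ^ 2 / 24 + of_int (2 * D * m1 + c) ^ 2 / (24 * of_int D))) z))
         summable_on UNIV"
  proof (rule Infinite_Sum.abs_summable_on_comparison_test', clarify)
    fix m1 m2 :: int
    have "norm (alt_sign (m1 + m2) * of_int (sgn (2 * D * m1 + c))) \<le> 1"
      by (simp add: norm_mult norm_alt_sign sgn_if)
    moreover have "norm (qpow \<tau> (of_int (6 * m2 + b + 4 * m1) ^ 2 / 24 + of_int (2 * D * m1 + c) ^ 2 / (24 * of_int D)))
        = (G \<circ> h) (m1, m2)"
      by (simp add: qpow_add norm_mult norm_qpow G_def h_def s_def t_def mult_ac)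
    moreover have "(G \<circ> h) (m1, m2) \<ge> 0" by (simp add: G_def h_def)
    ultimately show "norm (alt_sign (m1 + m2) * of_int (sgn (2 * D * m1 + c)) *
            qpow \<tau> (of_int (6 * m2 + b + 4 * m1) ^ 2 / 24 + of_int (2 * D * m1 + c) ^ 2 / (24 * of_int D)))
        \<le> (G \<circ> h) (m1, m2)"
      by (subst norm_mult) (simp add: mult_left_le_one_le)
  qed
  then show ?thesis by (rule abs_summable_summable)
qed

text \<open>Absolute summability allows summing over \<open>m2\<close> first; with \<open>m1\<close>
  fixed this is \<open>theta_has_sum\<close> at the odd number \<open>b + 4 * m1\<close>.\<close>

lemma infsum_double_theta:
  fixes b c D :: int
  assumes \<tau>: "Im \<tau> > 0" and "D > 0" "odd b"
  shows "(\<Sum>\<^sub>\<infinity>(m1, m2). alt_sign (m1 + m2) * of_int (sgn (2 * D * m1 + c)) *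
            qpow \<tau> (of_int (6 * m2 + b + 4 * m1) ^ 2 / 24 + of_int (2 * D * m1 + c) ^ 2 / (24 * of_int D)))
       = dedekind_eta \<tau> * (\<Sum>\<^sub>\<infinity>m. alt_sign m * of_int (chi12 (b + 4 * m)) * of_int (sgn (2 * D * m + c)) *
            qpow \<tau> (of_int (2 * D * m + c) ^ 2 / (24 * of_int D)))"
    (is "infsum ?F UNIV = _")
proof -
  have "infsum ?F UNIV = (\<Sum>\<^sub>\<infinity>m1. \<Sum>\<^sub>\<infinity>m2. ?F (m1, m2))"
    using infsum_Sigma_banach[of ?F UNIV "\<lambda>_. UNIV"] summable_double_theta[OF assms(1,2)]
    by simp
  also have "\<dots> = (\<Sum>\<^sub>\<infinity>m. dedekind_eta \<tau> * (alt_sign m * of_int (chi12 (b + 4 * m)) * of_int (sgn (2 * D * m + c)) *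
            qpow \<tau> (of_int (2 * D * m + c) ^ 2 / (24 * of_int D))))"
  proof (rule infsum_cong)
    fix m1 :: int
    define K where "K = alt_sign m1 * of_int (sgn (2 * D * m1 + c)) * qpow \<tau> (of_int (2 * D * m1 + c) ^ 2 / (24 * of_int D))"
    have "odd (b + 4 * m1)" using \<open>odd b\<close> by simp
    from infsumI[OF has_sum_cmult_right[OF theta_has_sum[OF \<tau> this], of K]]
    show "(\<Sum>\<^sub>\<infinity>m2. ?F (m1, m2)) = dedekind_eta \<tau> * (alt_sign m1 * of_int (chi12 (b + 4 * m1)) * of_int (sgn (2 * D * m1 + c)) *
            qpow \<tau> (of_int (2 * D * m1 + c) ^ 2 / (24 * of_int D)))"
      unfolding prod.case alt_sign_add qpow_add K_def by (simp only: mult_ac add.assoc)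
  qed
  finally show ?thesis by (simp add: infsum_cmult_right')
qed

text \<open>A shift by 6 negates \<open>chi12\<close>, so the sign can be absorbed by replacing
  \<open>b + 4 * m\<close> with \<open>b + 10 * m\<close>, which is congruent to
  \<open>- (2 * m - b)\<close> modulo 12; then \<open>chi12\<close> is even. The alternative
  \<open>u = 6 - b\<close> costs one more shift by 6, hence \<open>\<sigma> = - 1\<close>.\<close>

lemma alt_sign_chi12:
  assumes "\<sigma> = 1 \<and> u = - b \<or> \<sigma> = - 1 \<and> u = 6 - b"
  shows "alt_sign m * of_int (chi12 (b + 4 * m)) = of_int (\<sigma> * chi12 (2 * m + u))"
proof -
  have per: "chi12 (w + 12 * j) = chi12 w" for w j
    by (simp add: chi12_def)
  have "alt_sign m * of_int (chi12 (b + 4 * m)) = of_int (chi12 (b + 10 * m))"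
  proof (cases "even m")
    case True
    then obtain j where m: "m = 2 * j" by (rule evenE)
    have "b + 10 * m = (b + 4 * m) + 12 * j" by (simp add: m)
    then have "chi12 (b + 10 * m) = chi12 (b + 4 * m)" by (simp only: per)
    then show ?thesis using True by (simp add: alt_sign_def)
  next
    case False
    then obtain j where m: "m = 2 * j + 1" by (rule oddE)
    have "b + 10 * m = (b + 4 * m - 6) + 12 * (j + 1)" by (simp add: m)
    then have "chi12 (b + 10 * m) = - chi12 (b + 4 * m)" by (simp only: per chi12_diff_6)
    then show ?thesis using False by (simp add: alt_sign_def)
  qed
  also have "- (b + 10 * m) = (2 * m - b) + 12 * (- m)" by simp
  then have "chi12 (b + 10 * m) = chi12 (2 * m - b)" by (metis per chi12_minus)
  also have "chi12 (2 * m - b) = \<sigma> * chi12 (2 * m + u)"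
    using assms
  proof (elim disjE conjE)
    assume \<sigma>: "\<sigma> = - 1" and u: "u = 6 - b"
    have "2 * m - b = (2 * m + u) - 6" by (simp add: u)
    then show ?thesis by (simp only: chi12_diff_6 \<sigma> mult_minus1)
  qed simp
  finally show ?thesis .
qed

section \<open>The quadratic form and the lattice cosets in coordinates\<close>

lemma matA_components:
  "(matA p *v x) $ 1 = (2 * of_int p + 1) * x $ 1 + 2 * x $ 2"
  "(matA p *v x) $ 2 = 2 * x $ 1 + 3 * x $ 2"
  by (simp_all add: matA_def matrix_vector_mult_def sum_2)

text \<open>Completing the square in the second coordinate; \<open>D\<close> is the determinant of
  \<open>matA p\<close>.\<close>

lemma formQ_eq:
  assumes "D = 6 * p - 1"
  shows "formQ p x = 3/2 * (x $ 2 + 2/3 * x $ 1)^2 + of_int D / 6 * (x $ 1)^2"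
  by (simp add: formQ_def formB_def inner_vec_def sum_2 matA_components assms
      power2_eq_square field_simps)

text \<open>The vector (3, -2) is mapped by \<open>matA p\<close> to (D, 0), so the form only sees
  the first coordinate.\<close>

lemma sgn_formB:
  assumes "D = 6 * p - 1" "D > 0"
  shows "sgn (formB p x (c1 p)) = sgn (x $ 1)"
proof -
  have D: "6 * real_of_int p - 1 = of_int D" "real_of_int D > 0" using assms by auto
  define s where "s = 1 / sqrt (3 * of_int D)"
  have "s > 0" using D by (simp add: s_def)
  have c1: "c1 p = s *\<^sub>R vector [3, -2]" by (simp add: c1_def D s_def)
  have "formB p x (c1 p) = (s * of_int D) * x $ 1"
    by (simp add: formB_def inner_vec_def sum_2 matA_components c1 D(1)[symmetric] algebra_simps)
  moreover have "s * of_int D > 0" using \<open>s > 0\<close> D by simp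
  ultimately show ?thesis by (metis mult_1 sgn_mult sgn_pos)
qed

lemma mu_vec_components:
  fixes v :: "real^2"
  assumes "D = 6 * p - 1" "D > 0" and \<mu>: "\<mu> = (1/2) *\<^sub>R (matrix_inv (matA p) *v v)"
  shows "\<mu> $ 1 = (3 * v $ 1 - 2 * v $ 2) / (2 * of_int D)" "2 * \<mu> $ 1 + 3 * \<mu> $ 2 = v $ 2 / 2"
proof -
  have D: "6 * real_of_int p - 1 = of_int D" "real_of_int D > 0" using assms by auto
  have "det (matA p) = of_int D" by (simp add: det_2 matA_def D(1)[symmetric])
  then have "invertible (matA p)" using D by (simp add: invertible_det_nz)
  then have "matA p ** matrix_inv (matA p) = mat 1"
    unfolding invertible_def matrix_inv_def by (rule someI_ex[THEN conjunct1])
  then have "matA p *v (2 *\<^sub>R \<mu>) = v" by (simp add: \<mu> matrix_vector_mul_assoc)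
  then have e: "(2 * of_int p + 1) * (2 * \<mu> $ 1) + 2 * (2 * \<mu> $ 2) = v $ 1"
      "2 * (2 * \<mu> $ 1) + 3 * (2 * \<mu> $ 2) = v $ 2"
    using matA_components[of p "2 *\<^sub>R \<mu>"] by simp_all
  then show "2 * \<mu> $ 1 + 3 * \<mu> $ 2 = v $ 2 / 2" by simp
  have "2 * of_int D * \<mu> $ 1 = 3 * v $ 1 - 2 * v $ 2"
    unfolding e[symmetric] D(1)[symmetric] by (simp add: algebra_simps)
  then show "\<mu> $ 1 = (3 * v $ 1 - 2 * v $ 2) / (2 * of_int D)" using D by (simp add: field_simps)
qed

text \<open>Doubling the lattice points of \<open>latticeL\<close> is encoded as a parity condition
  on an integer pair. All four cosets thus share one summand and differ only in the index
  set.\<close>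

lemma false_theta2_coset:
  fixes \<mu> :: "real^2" and b c D :: int
  assumes D: "D = 6 * p - 1" "D > 0"
    and \<mu>: "\<mu> $ 1 = of_int c / (2 * of_int D)" "2 * \<mu> $ 1 + 3 * \<mu> $ 2 = of_int b / 2"
  shows "false_theta2 p (\<mu> + vector [real \<epsilon>1, real \<epsilon>2]) \<tau> =
    (\<Sum>\<^sub>\<infinity>(m1, m2)\<in>{(m1, m2). even (m1 - int \<epsilon>1) \<and> even (m2 - int \<epsilon>2)}. of_int (sgn (2 * D * m1 + c)) *
       qpow \<tau> (of_int (6 * m2 + b + 4 * m1) ^ 2 / 24 + of_int (2 * D * m1 + c) ^ 2 / (24 * of_int D)))"
    (is "_ = infsum ?f ?Z")
proof -
  define h :: "int \<times> int \<Rightarrow> real^2" where "h = (\<lambda>(m1, m2). vector [of_int m1, of_int m2] + \<mu>)"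
  have inj: "inj_on h A" for A
    by (auto simp: h_def inj_on_def vec_eq_iff forall_2)
  have img: "{l + (\<mu> + vector [real \<epsilon>1, real \<epsilon>2]) |l. l \<in> latticeL} = h ` ?Z"
  proof (intro equalityI subsetI)
    fix x assume "x \<in> {l + (\<mu> + vector [real \<epsilon>1, real \<epsilon>2]) |l. l \<in> latticeL}"
    then obtain l where l: "l \<in> latticeL" "x = l + (\<mu> + vector [real \<epsilon>1, real \<epsilon>2])" by blast
    obtain i j where ij: "l $ 1 = 2 * of_int i" "l $ 2 = 2 * of_int j"
      using l(1) unfolding latticeL_def by blast
    have "x = h (2 * i + int \<epsilon>1, 2 * j + int \<epsilon>2)"
      by (simp add: l(2) h_def vec_eq_iff forall_2 ij)
    then show "x \<in> h ` ?Z" by auto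
  next
    fix x assume "x \<in> h ` ?Z"
    then obtain m1 m2 where m: "x = h (m1, m2)" "even (m1 - int \<epsilon>1)" "even (m2 - int \<epsilon>2)" by auto
    obtain i where i: "m1 - int \<epsilon>1 = 2 * i" using m(2) by (elim dvdE)
    obtain j where j: "m2 - int \<epsilon>2 = 2 * j" using m(3) by (elim dvdE)
    from i j have m12: "m1 = 2 * i + int \<epsilon>1" "m2 = 2 * j + int \<epsilon>2" by auto
    have "x = vector [2 * of_int i, 2 * of_int j] + (\<mu> + vector [real \<epsilon>1, real \<epsilon>2])"
      by (simp add: m(1) h_def vec_eq_iff forall_2 m12)
    moreover have "vector [2 * of_int i, 2 * of_int j] \<in> latticeL"
      by (auto simp: latticeL_def forall_2)
    ultimately show "x \<in> {l + (\<mu> + vector [real \<epsilon>1, real \<epsilon>2]) |l. l \<in> latticeL}" by blast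
  qed
  have f: "of_real (sgn (formB p (h z) (c1 p))) * qpow \<tau> (formQ p (h z)) = ?f z" for z
  proof (cases z)
    case (Pair m1 m2)
    have Dr: "real_of_int D > 0" using D(2) by simp
    have h1: "h z $ 1 = of_int (2 * D * m1 + c) / (2 * of_int D)"
      using Dr by (simp add: Pair h_def \<mu>(1) field_simps)
    have h2: "h z $ 2 + 2/3 * h z $ 1 = of_int (6 * m2 + b + 4 * m1) / 6"
      using \<mu>(2) by (simp add: Pair h_def field_simps)
    have "sgn (of_int x / (2 * of_int D) :: real) = of_int (sgn x)" for x
      using Dr by (auto simp: sgn_if zero_less_divide_iff)
    then have "sgn (h z $ 1) = of_int (sgn (2 * D * m1 + c))" by (simp only: h1)
    moreover have "formQ p (h z) = of_int (6 * m2 + b + 4 * m1) ^ 2 / 24 + of_int (2 * D * m1 + c) ^ 2 / (24 * of_int D)"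
    proof -
      have "3/2 * (x / 6)^2 + of_int D / 6 * (y / (2 * of_int D))^2 = x^2 / 24 + y^2 / (24 * of_int D)" for x y :: real
        using Dr by (simp add: power2_eq_square field_simps)
      then show ?thesis by (simp only: formQ_eq[OF D(1)] h2) (simp only: h1)
    qed
    ultimately show ?thesis by (simp add: Pair sgn_formB[OF D])
  qed
  show ?thesis unfolding false_theta2_def img by (simp add: infsum_reindex[OF inj] o_def f)
qed

text \<open>The four parity classes partition the integer pairs, and on each of them
  \<open>alt_sign (m1 + m2)\<close> is the constant sign of that coset.\<close>

lemma sum_false_theta2:
  fixes \<mu> :: "real^2" and b c D :: int
  assumes D: "D = 6 * p - 1" "D > 0" and \<tau>: "Im \<tau> > 0"
    and \<mu>: "\<mu> $ 1 = of_int c / (2 * of_int D)" "2 * \<mu> $ 1 + 3 * \<mu> $ 2 = of_int b / 2"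
  shows "(\<Sum>\<epsilon>1\<in>{0, 1::nat}. \<Sum>\<epsilon>2\<in>{0, 1::nat}. (-1) ^ (\<epsilon>1 + \<epsilon>2) *
            false_theta2 p (\<mu> + vector [real \<epsilon>1, real \<epsilon>2]) \<tau>) =
    (\<Sum>\<^sub>\<infinity>(m1, m2). alt_sign (m1 + m2) * of_int (sgn (2 * D * m1 + c)) *
            qpow \<tau> (of_int (6 * m2 + b + 4 * m1) ^ 2 / 24 + of_int (2 * D * m1 + c) ^ 2 / (24 * of_int D)))"
    (is "_ = infsum ?F UNIV")
proof -
  define Z where "Z \<epsilon>1 \<epsilon>2 = {(m1::int, m2::int). even (m1 - int \<epsilon>1) \<and> even (m2 - int \<epsilon>2)}" for \<epsilon>1 \<epsilon>2
  have part: "(-1) ^ (\<epsilon>1 + \<epsilon>2) * false_theta2 p (\<mu> + vector [real \<epsilon>1, real \<epsilon>2]) \<tau> = infsum ?F (Z \<epsilon>1 \<epsilon>2)" for \<epsilon>1 \<epsilon>2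
    unfolding false_theta2_coset[OF D \<mu>] Z_def[symmetric] infsum_cmult_right'[symmetric]
  proof (rule infsum_cong, clarify)
    fix m1 m2 assume "(m1, m2) \<in> Z \<epsilon>1 \<epsilon>2"
    then have "alt_sign (m1 + m2) = (-1) ^ (\<epsilon>1 + \<epsilon>2)"
      by (auto simp: Z_def alt_sign_def)
    then show "(-1) ^ (\<epsilon>1 + \<epsilon>2) * (of_int (sgn (2 * D * m1 + c)) *
        qpow \<tau> (of_int (6 * m2 + b + 4 * m1) ^ 2 / 24 + of_int (2 * D * m1 + c) ^ 2 / (24 * of_int D))) =
      alt_sign (m1 + m2) * of_int (sgn (2 * D * m1 + c)) *
        qpow \<tau> (of_int (6 * m2 + b + 4 * m1) ^ 2 / 24 + of_int (2 * D * m1 + c) ^ 2 / (24 * of_int D))"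
      by (simp only: mult.assoc)
  qed
  have summ: "?F summable_on A" for A
    by (rule summable_on_subset_banach[OF summable_double_theta[OF \<tau> D(2)]]) simp
  have "(\<Sum>\<epsilon>1\<in>{0, 1::nat}. \<Sum>\<epsilon>2\<in>{0, 1::nat}. infsum ?F (Z \<epsilon>1 \<epsilon>2))
      = (infsum ?F (Z 0 0) + infsum ?F (Z 0 1)) + (infsum ?F (Z 1 0) + infsum ?F (Z 1 1))"
    by simp
  also have "\<dots> = infsum ?F ((Z 0 0 \<union> Z 0 1) \<union> (Z 1 0 \<union> Z 1 1))"
  proof -
    have "infsum ?F (Z 0 0 \<union> Z 0 1) = infsum ?F (Z 0 0) + infsum ?F (Z 0 1)"
      by (rule infsum_Un_disjoint[OF summ summ]) (auto simp: Z_def)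
    moreover have "infsum ?F (Z 1 0 \<union> Z 1 1) = infsum ?F (Z 1 0) + infsum ?F (Z 1 1)"
      by (rule infsum_Un_disjoint[OF summ summ]) (auto simp: Z_def)
    moreover have "infsum ?F ((Z 0 0 \<union> Z 0 1) \<union> (Z 1 0 \<union> Z 1 1)) = infsum ?F (Z 0 0 \<union> Z 0 1) + infsum ?F (Z 1 0 \<union> Z 1 1)"
      by (rule infsum_Un_disjoint[OF summ summ]) (auto simp: Z_def)
    ultimately show ?thesis by simp
  qed
  also have "(Z 0 0 \<union> Z 0 1) \<union> (Z 1 0 \<union> Z 1 1) = UNIV" by (auto simp: Z_def)
  finally show ?thesis by (simp only: part)
qed

section \<open>The limit at \<open>1/N\<close>\<close>

text \<open>Pairing \<open>n\<close> with \<open>M - n\<close> cancels all terms but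
  \<open>f 0\<close>, which is 0 by oddness.\<close>

lemma odd_periodic_sum_zero:
  fixes f :: "int \<Rightarrow> complex"
  assumes "\<And>n. f (- n) = - f n" "\<And>n. f (n + int M) = f n"
  shows "(\<Sum>n<M. f (int n)) = 0"
proof (cases "M = 0")
  case False
  define S where "S = (\<Sum>n\<in>{0<..<M}. f (int n))"
  have "f 0 = 0" using assms(1)[of 0] by simp
  have "S = (\<Sum>n\<in>{0<..<M}. f (int (M - n)))"
    unfolding S_def by (rule sum.reindex_bij_witness[where i="\<lambda>n. M - n" and j="\<lambda>n. M - n"]) auto
  also have "\<dots> = (\<Sum>n\<in>{0<..<M}. - f (int n))"
  proof (rule sum.cong)
    fix n assume "n \<in> {0<..<M}"
    then have "int (M - n) = - int n + int M" by auto
    then show "f (int (M - n)) = - f (int n)" by (simp only: assms)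
  qed simp
  also have "\<dots> = - S" by (simp add: S_def sum_negf)
  finally have "S = 0" by simp
  moreover have "{..<M} = insert 0 {0<..<M}" using False by auto
  ultimately show ?thesis using \<open>f 0 = 0\<close> by (simp add: S_def)
qed simp

lemma Phi_tilde_limit:
  assumes D: "D > 0" "coprime D 12" and l: "\<not> D dvd l" and "N \<ge> 1"
  shows "\<exists>L. ((\<lambda>t. Phi_tilde (2, 3, D) (1, 1, l) (Complex (1 / of_int N) t)) \<longlongrightarrow> L) (at_right 0)"
proof -
  define f :: "int \<Rightarrow> complex" where
    "f n = of_int (chi (2, 3, D) (1, 1, l) n) * cis (2 * pi * (of_int n ^ 2 / (24 * of_int (D * N))))" for n
  \<comment> \<open>A shift by \<open>12 * D * N\<close> preserves \<open>chi\<close>, whose period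
    is \<open>12 * D\<close>, and changes \<open>n^2 / (24 * D * N)\<close> by the integer
    \<open>n + 6 * D * N\<close>.\<close>
  define M where "M = nat (12 * D * N)"
  have M: "M > 0" "int M = 12 * D * N" using D \<open>N \<ge> 1\<close> by (simp_all add: M_def)
  have DN: "real_of_int (D * N) \<noteq> 0" using D \<open>N \<ge> 1\<close> by simp
  have odd: "f (- n) = - f n" for n by (simp add: f_def chi_minus[OF D l])
  have per: "f (n + int M) = f n" for n
  proof -
    have "2 * pi * (of_int (n + 12 * D * N) ^ 2 / (24 * of_int (D * N)))
        = 2 * pi * (of_int n ^ 2 / (24 * of_int (D * N))) + 2 * pi * of_int (n + 6 * D * N)"
      using DN by (simp add: field_simps power2_eq_square)
    then have "cis (2 * pi * (of_int (n + 12 * D * N) ^ 2 / (24 * of_int (D * N))))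
        = cis (2 * pi * (of_int n ^ 2 / (24 * of_int (D * N))))"
      by (simp only: cis_mult[symmetric] cis_multiple_2pi[OF Ints_of_int] mult_1_right)
    then show ?thesis unfolding f_def M(2) by (simp only: chi_periodic[OF D l])
  qed
  have "f (int n + int M) = f (int n)" for n by (rule per)
  then obtain L where L: "((\<lambda>s. \<Sum>n. f (int n) * of_real (exp (- s * real n ^ 2))) \<longlongrightarrow> L) (at_right 0)"
    using gaussian_sum_limit[OF M(1), of "\<lambda>n. f (int n)"] odd_periodic_sum_zero[OF odd per] by auto
  define a where "a = 2 * pi / (24 * of_int D)"
  have "a > 0" using D by (simp add: a_def)
  have "filterlim (\<lambda>t. a * t) (at_right 0) (at_right 0)"
    using \<open>a > 0\<close> by real_asymp
  from filterlim_compose[OF L this]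
  have "((\<lambda>t. \<Sum>n. f (int n) * of_real (exp (- (a * t) * real n ^ 2))) \<longlongrightarrow> L) (at_right 0)" .
  moreover have "(\<Sum>n. f (int n) * of_real (exp (- (a * t) * real n ^ 2))) =
      Phi_tilde (2, 3, D) (1, 1, l) (Complex (1 / of_int N) t)" for t
  proof -
    have "f (int n) * of_real (exp (- (a * t) * real n ^ 2)) =
       of_int (chi (2, 3, D) (1, 1, l) (int n)) * qpow (Complex (1 / of_int N) t) (real (n^2) / (4 * of_int (2 * 3 * D)))" for n
    proof -
      have "qpow (Complex (1 / of_int N) t) (real (n^2) / (4 * of_int (2 * 3 * D))) =
          exp (\<i> * of_real (2 * pi * (real n ^ 2 / (24 * of_int (D * N)))) + of_real (- (a * t) * real n ^ 2))"
        unfolding qpow_def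
        by (rule arg_cong[where f=exp]) (simp add: complex_eq_iff a_def field_simps)
      then show ?thesis by (simp only: exp_add cis_conv_exp[symmetric] f_def of_int_of_nat_eq exp_of_real[symmetric] mult.assoc)
    qed
    then show ?thesis by (simp add: Phi_tilde_def)
  qed
  ultimately show ?thesis by auto
qed

text \<open>Writing \<open>\<mu>\<^sub>k = A\<^sup>-\<^sup>1 (a, b) / 2\<close>, the number \<open>c\<close> is \<open>3 a - 2 b\<close>.\<close>

lemma mu_vec_parameters:
  assumes "p \<ge> 1" and "k \<in> {1, 2, 3, 4, 5}" and D: "D = 6 * p - 1"
  obtains \<sigma> u b c where "\<sigma> = 1 \<and> u = - b \<or> \<sigma> = - 1 \<and> u = 6 - b" "odd b"
    "c = \<sigma> * (6 * ell p k) + u * D"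
    "mu_vec p k $ 1 = of_int c / (2 * of_int D)" "2 * mu_vec p k $ 1 + 3 * mu_vec p k $ 2 = of_int b / 2"
proof -
  have "D > 0" using assms by simp
  note mu = mu_vec_components[OF D \<open>D > 0\<close> mu_vec_def]
  note result = that
  have *: thesis if "\<sigma> = 1 \<and> u = - b \<or> \<sigma> = - 1 \<and> u = 6 - b" "odd b"
    "3 * a - 2 * b = \<sigma> * (6 * ell p k) + u * D"
    "([vector [2 * of_int p + 1, 5], vector [1, 1], vector [2 * of_int p + 3, 3],
       vector [2 * of_int p + 1, 1], vector [1, 3]] ! (k - 1) :: real^2) = vector [of_int a, of_int b]"
    for \<sigma> u a b
  proof (rule result[OF that(1-3)])
    show "mu_vec p k $ 1 = of_int (3 * a - 2 * b) / (2 * of_int D)"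
      unfolding mu(1) that(4) by simp
    show "2 * mu_vec p k $ 1 + 3 * mu_vec p k $ 2 = of_int b / 2"
      unfolding mu(2) that(4) by simp
  qed
  show thesis using assms(2)
  proof (elim insertE emptyE)
    assume k: "k = 1"
    \<comment> \<open>The instances here and below are \<open>\<sigma>\<close>, \<open>u\<close>,
      \<open>b\<close>, \<open>a\<close> in this order. For \<open>k = 1\<close>,
      \<open>c = 3 * (2 * p + 1) - 10 = - 6 + D\<close>.\<close>
    show thesis by (rule *[of "-1" 1 5 "2 * p + 1"]) (simp_all add: k ell_def D)
  next
    assume k: "k = 2"
    show thesis by (rule *[of 1 "-1" 1 1]) (simp_all add: k ell_def D)
  next
    assume k: "k = 3"
    show thesis by (rule *[of "-1" 3 3 "2 * p + 3"]) (simp_all add: k ell_def D)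
  next
    assume k: "k = 4"
    show thesis by (rule *[of 1 "-1" 1 "2 * p + 1"]) (simp_all add: k ell_def D)
  next
    assume k: "k = 5"
    show thesis by (rule *[of 1 "-3" 3 1]) (simp_all add: k ell_def D)
  qed
qed

section \<open>The identity for every t > 0 and passage to the limit\<close>

theorem theorem3p21:
  fixes p N :: int and k :: nat
  assumes "p \<ge> 1" and "N \<ge> 1" and "k \<in> {1, 2, 3, 4, 5}"
  defines "\<tau> \<equiv> (\<lambda>t::real. Complex (1 / of_int N) t)"
  defines "pref \<equiv> (\<lambda>t::real. qpow (\<tau> t) (- (of_int (e_num p k) / (24 * (6 * of_int p - 1)))))"
  shows "\<exists>lhs rhs.
    ((\<lambda>t. pref t / (2 * dedekind_eta (\<tau> t)) *
        (\<Sum>\<epsilon>1\<in>{0, 1::nat}. \<Sum>\<epsilon>2\<in>{0, 1::nat}.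
          (-1) ^ (\<epsilon>1 + \<epsilon>2) *
          false_theta2 p (mu_vec p k + vector [real \<epsilon>1, real \<epsilon>2]) (\<tau> t)))
      \<longlongrightarrow> lhs) (at_right 0) \<and>
    ((\<lambda>t. pref t * Phi_tilde (2, 3, 6 * p - 1) (1, 1, ell p k) (\<tau> t))
      \<longlongrightarrow> rhs) (at_right 0) \<and>
    lhs = - (1/2) * rhs"
proof -
  define D where "D = 6 * p - 1"
  have D: "D > 0" using assms(1) by (simp add: D_def)
  \<comment> \<open>Being one less than \<open>6 * p\<close>, \<open>D\<close> is coprime to 6,
    hence to 36 and to its divisor 12.\<close>
  have "coprime D (6 * p)" unfolding D_def by (rule coprime_diff_one_left)
  then have "coprime D (6 * 6)" by (simp only: coprime_mult_right_iff)
  then have cop: "coprime D 12" by (rule coprime_divisors[rotated 2]) simp_all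
  have "0 < ell p k" "ell p k < D" using assms(1,3) by (auto simp: ell_def D_def)
  then have ell: "\<not> D dvd ell p k" by (rule zdvd_not_zless)
  obtain \<sigma> u b c where par: "\<sigma> = 1 \<and> u = - b \<or> \<sigma> = - 1 \<and> u = 6 - b" "odd b"
    "c = \<sigma> * (6 * ell p k) + u * D"
    "mu_vec p k $ 1 = of_int c / (2 * of_int D)" "2 * mu_vec p k $ 1 + 3 * mu_vec p k $ 2 = of_int b / 2"
    by (rule mu_vec_parameters[OF assms(1,3) D_def])
  have \<sigma>: "\<sigma> \<in> {1, -1}" and u: "odd u" using par(1,2) by auto
  define S where "S t = (\<Sum>\<epsilon>1\<in>{0, 1::nat}. \<Sum>\<epsilon>2\<in>{0, 1::nat}. (-1) ^ (\<epsilon>1 + \<epsilon>2) *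
          false_theta2 p (mu_vec p k + vector [real \<epsilon>1, real \<epsilon>2]) (\<tau> t))" for t
  define \<Phi> where "\<Phi> t = Phi_tilde (2, 3, D) (1, 1, ell p k) (\<tau> t)" for t
  have S: "S t = - (dedekind_eta (\<tau> t) * \<Phi> t)" if "t > 0" for t
  proof -
    have Im: "Im (\<tau> t) > 0" using that by (simp add: \<tau>_def)
    have "S t = dedekind_eta (\<tau> t) * (\<Sum>\<^sub>\<infinity>m. alt_sign m * of_int (chi12 (b + 4 * m)) * of_int (sgn (2 * D * m + c)) *
            qpow (\<tau> t) (of_int (2 * D * m + c) ^ 2 / (24 * of_int D)))"
      unfolding S_def sum_false_theta2[OF D_def D Im par(4,5)] by (rule infsum_double_theta[OF Im D par(2)])
    also have "\<dots> = - (dedekind_eta (\<tau> t) * \<Phi> t)"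
      using infsum_unary_eq_Phi_tilde[OF D cop ell \<sigma> u par(3) Im]
      unfolding alt_sign_chi12[OF par(1)] of_int_mult[symmetric] by (simp add: \<Phi>_def)
    finally show ?thesis .
  qed
  obtain L where L: "(\<Phi> \<longlongrightarrow> L) (at_right 0)"
    using Phi_tilde_limit[OF D cop ell assms(2)] unfolding \<Phi>_def[abs_def] \<tau>_def by blast
  \<comment> \<open>The prefactor is entire in the variable \<tau>, so it has a limit at the real
    point \<open>1/N\<close> and does not affect existence.\<close>
  have "continuous_on UNIV pref"
    unfolding pref_def qpow_def \<tau>_def Complex_eq by (intro continuous_intros)
  then have "(pref \<longlongrightarrow> pref 0) (at_right 0)"
    by (simp add: continuous_on_eq_continuous_at isCont_def filterlim_at_split)
  from tendsto_mult[OF this L] have rhs: "((\<lambda>t. pref t * \<Phi> t) \<longlongrightarrow> pref 0 * L) (at_right 0)" .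
  have "((\<lambda>t. - (1/2) * (pref t * \<Phi> t)) \<longlongrightarrow> - (1/2) * (pref 0 * L)) (at_right 0)"
    by (intro tendsto_intros rhs)
  moreover have "\<forall>\<^sub>F t in at_right 0. - (1/2) * (pref t * \<Phi> t) = pref t / (2 * dedekind_eta (\<tau> t)) * S t"
    using eventually_at_right_less[of "0::real"]
  proof eventually_elim
    case (elim t)
    then have "dedekind_eta (\<tau> t) \<noteq> 0" by (intro dedekind_eta_nonzero) (simp add: \<tau>_def)
    then show ?case by (simp add: S[OF elim])
  qed
  ultimately have "((\<lambda>t. pref t / (2 * dedekind_eta (\<tau> t)) * S t) \<longlongrightarrow> - (1/2) * (pref 0 * L)) (at_right 0)"
    by (rule Lim_transform_eventually)
  with rhs show ?thesis unfolding S_def[symmetric] D_def[symmetric] \<Phi>_def[symmetric] by blast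
qed

end
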